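(* There is no algorithm which, given finite alphabets $Y$, $A$ and homomorphisms $g,h\colon F_Y\to F_A$ between the finitely generated free groups $F_Y$ and $F_A$, with $h$ injective and with image of $h$ of finite index in $F_A$, decides whether $\operatorname{Eq}(g,h)\neq\{1\}$.
   Context: $F_X$ denotes the free group on a finite alphabet $X$. A homomorphism $F_Y\to F_A$ is given as input by listing the images of the generators $y\in Y$ as words over $A\cup A^{-1}$. The equalizer of $g,h$ is $\operatorname{Eq}(g,h)=\{x\in F_Y\mid xg=xh\}$ (maps are written on the right). The conditions on $h$ are a promise on the input: the claim is that no algorithm answers correctly on all inputs satisfying them. *)

theory Defs
  imports "HOL-Algebra.Coset" "HOL-Library.Nat_Bijection"
begin

text \<open>The letter \<open>(x, True)\<close> is the generator \<open>x\<close>, and \<open>(x, False)\<close> is its formal inverse.\<close>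

type_synonym 'a letter = "'a \<times> bool"
type_synonym 'a word = "'a letter list"

definition inv_letter :: "'a letter \<Rightarrow> 'a letter" where
  "inv_letter p = (fst p, \<not> snd p)"

definition inv_word :: "'a word \<Rightarrow> 'a word" where
  "inv_word w = rev (map inv_letter w)"

definition words_over :: "'a set \<Rightarrow> 'a word set" where
  "words_over X = {w. fst ` set w \<subseteq> X}"

definition reduced :: "'a word \<Rightarrow> bool" where
  "reduced w \<longleftrightarrow> successively (\<lambda>p q. q \<noteq> inv_letter p) w"

fun cancel_cons :: "'a letter \<Rightarrow> 'a word \<Rightarrow> 'a word" where
  "cancel_cons p [] = [p]"
| "cancel_cons p (q # w) = (if q = inv_letter p then w else p # q # w)"

definition reduce :: "'a word \<Rightarrow> 'a word" where
  "reduce w = foldr cancel_cons w []"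

definition free_group :: "'a set \<Rightarrow> 'a word monoid" where
  "free_group X =
     \<lparr>carrier = {w \<in> words_over X. reduced w}, mult = (\<lambda>u v. reduce (u @ v)), one = []\<rparr>"

lemma inv_letter_inv_letter [simp]: "inv_letter (inv_letter p) = p"
  by (simp add: inv_letter_def)

lemma inv_letter_neq [simp]: "inv_letter p \<noteq> p"
  by (cases p) (simp add: inv_letter_def)

lemma reduced_Nil [simp]: "reduced []"
  by (simp add: reduced_def)

lemma reduced_ConsD: "reduced (p # w) \<Longrightarrow> reduced w"
  by (cases w) (auto simp: reduced_def)

lemma cancel_cons_reduced: "reduced w \<Longrightarrow> reduced (cancel_cons p w)"
  by (cases w) (auto simp: reduced_def dest: reduced_ConsD[unfolded reduced_def])

lemma cancel_cons_eq: "reduced (p # w) \<Longrightarrow> cancel_cons p w = p # w"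
  by (cases w) (auto simp: reduced_def)

lemma cancel_cons_inv: "reduced w \<Longrightarrow> cancel_cons p (cancel_cons (inv_letter p) w) = w"
proof (cases w)
  case (Cons q v)
  assume "reduced w"
  then show ?thesis using Cons by (cases "q = p") (auto intro: cancel_cons_eq)
qed simp

lemma foldr_cancel_cons_reduced: "reduced v \<Longrightarrow> reduced (foldr cancel_cons w v)"
  by (induction w) (auto intro: cancel_cons_reduced)

lemma reduce_reduced [simp]: "reduced (reduce w)"
  by (simp add: reduce_def foldr_cancel_cons_reduced)

lemma reduce_id: "reduced w \<Longrightarrow> reduce w = w"
proof (induction w)
  case (Cons p w)
  then have "reduce w = w" by (blast dest: reduced_ConsD)
  then show ?case using Cons.prems by (simp add: reduce_def cancel_cons_eq)
qed (simp add: reduce_def)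

lemma foldr_cancel_cons_cancel_cons:
  "reduced v \<Longrightarrow> foldr cancel_cons (cancel_cons p w) v = cancel_cons p (foldr cancel_cons w v)"
  by (cases w) (auto simp: cancel_cons_inv foldr_cancel_cons_reduced)

lemma foldr_cancel_cons_reduce:
  "reduced v \<Longrightarrow> foldr cancel_cons (reduce w) v = foldr cancel_cons w v"
  by (induction w) (auto simp: reduce_def foldr_cancel_cons_cancel_cons)

lemma reduce_append: "reduce (u @ v) = foldr cancel_cons u (reduce v)"
  by (simp add: reduce_def)

lemma reduce_append_left [simp]: "reduce (reduce u @ v) = reduce (u @ v)"
  by (simp add: reduce_append foldr_cancel_cons_reduce)

lemma reduce_append_right [simp]: "reduce (u @ reduce v) = reduce (u @ v)"
  by (simp add: reduce_append reduce_id)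

lemma reduce_inv_word_left [simp]: "reduce (inv_word w @ w) = []"
proof (induction w)
  case (Cons p w)
  have "reduce (inv_word (p # w) @ p # w)
      = foldr cancel_cons (inv_word w) (cancel_cons (inv_letter p) (cancel_cons p (reduce w)))"
    by (simp add: inv_word_def reduce_def)
  also have "\<dots> = reduce (inv_word w @ w)"
    using cancel_cons_inv[of "reduce w" "inv_letter p"] by (simp add: reduce_append)
  finally show ?case using Cons.IH by simp
qed (simp add: inv_word_def reduce_def)

lemma inv_word_inv_word [simp]: "inv_word (inv_word w) = w"
  by (induction w) (auto simp: inv_word_def)

lemma reduce_inv_word_right [simp]: "reduce (w @ inv_word w) = []"
  using reduce_inv_word_left[of "inv_word w"] by simp

lemma set_cancel_cons: "set (cancel_cons p w) \<subseteq> insert p (set w)"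
  by (cases w) auto

lemma set_reduce: "set (reduce w) \<subseteq> set w"
proof (induction w)
  case (Cons p w)
  then show ?case using set_cancel_cons[of p "reduce w"] by (auto simp: reduce_def)
qed (simp add: reduce_def)

lemma reduce_words_over: "w \<in> words_over X \<Longrightarrow> reduce w \<in> words_over X"
  using set_reduce[of w] by (auto simp: words_over_def)

lemma inv_word_words_over: "w \<in> words_over X \<Longrightarrow> inv_word w \<in> words_over X"
  by (auto simp: words_over_def inv_word_def inv_letter_def)

lemma append_words_over: "u @ v \<in> words_over X \<longleftrightarrow> u \<in> words_over X \<and> v \<in> words_over X"
  by (auto simp: words_over_def)

lemma free_group_simps [simp]:
  "u \<in> carrier (free_group X) \<longleftrightarrow> u \<in> words_over X \<and> reduced u"
  "u \<otimes>\<^bsub>free_group X\<^esub> v = reduce (u @ v)"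
  "\<one>\<^bsub>free_group X\<^esub> = []"
  by (simp_all add: free_group_def)

theorem group_free_group: "group (free_group X)"
proof (rule groupI)
  fix w assume "w \<in> carrier (free_group X)"
  then show "\<exists>v\<in>carrier (free_group X). v \<otimes>\<^bsub>free_group X\<^esub> w = \<one>\<^bsub>free_group X\<^esub>"
    by (intro bexI[of _ "reduce (inv_word w)"]) (simp_all add: reduce_words_over inv_word_words_over)
qed (simp_all add: reduce_words_over append_words_over reduce_id, simp add: words_over_def)

lemma inv_free_group:
  assumes "w \<in> carrier (free_group X)"
  shows "inv\<^bsub>free_group X\<^esub> w = reduce (inv_word w)"
  using assms
  by (intro group.inv_equality[OF group_free_group])
     (simp_all add: reduce_words_over inv_word_words_over)

definition subst_letter :: "('a \<Rightarrow> 'b word) \<Rightarrow> 'a letter \<Rightarrow> 'b word" where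
  "subst_letter \<phi> p = (if snd p then \<phi> (fst p) else inv_word (\<phi> (fst p)))"

definition subst_word :: "('a \<Rightarrow> 'b word) \<Rightarrow> 'a word \<Rightarrow> 'b word" where
  "subst_word \<phi> w = reduce (concat (map (subst_letter \<phi>) w))"

lemma subst_word_append: "subst_word \<phi> (u @ v) = reduce (subst_word \<phi> u @ subst_word \<phi> v)"
  by (simp add: subst_word_def)

lemma subst_letter_inv: "reduce (subst_letter \<phi> p @ subst_letter \<phi> (inv_letter p)) = []"
  by (simp add: subst_letter_def inv_letter_def)

lemma subst_word_cancel_cons: "subst_word \<phi> (cancel_cons p w) = subst_word \<phi> (p # w)"
proof (cases w)
  case (Cons q v)
  show ?thesis
  proof (cases "q = inv_letter p")
    case True
    have "subst_word \<phi> (p # w)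
        = reduce (reduce (subst_letter \<phi> p @ subst_letter \<phi> (inv_letter p)) @ concat (map (subst_letter \<phi>) v))"
      using Cons True by (simp add: subst_word_def)
    then show ?thesis using Cons True by (simp add: subst_letter_inv subst_word_def)
  qed (use Cons in simp)
qed simp

lemma subst_word_reduce: "subst_word \<phi> (reduce w) = subst_word \<phi> w"
proof (induction w)
  case (Cons p w)
  have "subst_word \<phi> (reduce (p # w)) = subst_word \<phi> ([p] @ reduce w)"
    by (simp add: reduce_def subst_word_cancel_cons)
  then show ?case
    using Cons subst_word_append[of \<phi> "[p]" w] subst_word_append[of \<phi> "[p]" "reduce w"] by simp
qed (simp add: reduce_def)

lemma subst_word_hom:
  assumes "\<And>x. x \<in> X \<Longrightarrow> \<phi> x \<in> words_over A"
  shows "subst_word \<phi> \<in> hom (free_group X) (free_group A)"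
proof (rule homI)
  fix w assume "w \<in> carrier (free_group X)"
  then have "w \<in> words_over X" by simp
  then have "concat (map (subst_letter \<phi>) w) \<in> words_over A"
  proof (induction w)
    case (Cons p w)
    then have "subst_letter \<phi> p \<in> words_over A"
      using assms by (auto simp: words_over_def[of X] subst_letter_def inv_word_words_over)
    with Cons show ?case by (auto simp: append_words_over words_over_def[of X])
  qed (simp add: words_over_def)
  then show "subst_word \<phi> w \<in> carrier (free_group A)"
    by (simp add: subst_word_def reduce_words_over)
qed (simp add: subst_word_reduce subst_word_append)

lemma hom_free_group_eq_subst_word:
  assumes g: "g \<in> hom (free_group X) (free_group A)"
    and gen: "\<And>x. x \<in> X \<Longrightarrow> g [(x, True)] = reduce (\<phi> x)"
    and w: "w \<in> carrier (free_group X)"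
  shows "g w = subst_word \<phi> w"
proof -
  interpret G: group "free_group X" by (rule group_free_group)
  interpret H: group "free_group A" by (rule group_free_group)
  interpret group_hom "free_group X" "free_group A" g
    by unfold_locales (rule g)
  have letter: "g [(x, b)] = reduce (subst_letter \<phi> (x, b))" if "x \<in> X" for x b
  proof (cases b)
    case False
    have c: "[(x, True)] \<in> carrier (free_group X)"
      using that by (simp add: words_over_def reduced_def)
    have "inv\<^bsub>free_group X\<^esub> [(x, True)] = [(x, False)]"
      using inv_free_group[OF c]
      by (simp add: inv_word_def inv_letter_def reduce_def)
    then have "g [(x, False)] = inv\<^bsub>free_group A\<^esub> (reduce (\<phi> x))"
      using hom_inv[OF c] gen[OF that] by simp
    also have "\<dots> = reduce (inv_word (\<phi> x))"
    proof (rule H.inv_equality)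
      have "reduce (\<phi> x) \<in> carrier (free_group A)"
        using hom_closed[OF c] gen[OF that] by simp
      then show "reduce (\<phi> x) \<in> carrier (free_group A)" .
      then have "reduce (inv_word (reduce (\<phi> x))) \<in> carrier (free_group A)"
        by (simp add: inv_word_words_over reduce_words_over)
      moreover have "reduce (inv_word (reduce (\<phi> x))) = reduce (inv_word (\<phi> x))"
      proof -
        have "reduce (inv_word (reduce (\<phi> x)))
            = reduce (inv_word (reduce (\<phi> x)) @ reduce (\<phi> x @ inv_word (\<phi> x)))" by simp
        also have "\<dots> = reduce (reduce (inv_word (reduce (\<phi> x)) @ reduce (\<phi> x)) @ inv_word (\<phi> x))"
          by (metis append.assoc reduce_append_left reduce_append_right)
        finally show ?thesis by (simp only: reduce_inv_word_left append_Nil)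
      qed
      ultimately show "reduce (inv_word (\<phi> x)) \<in> carrier (free_group A)" by simp
    qed simp
    finally show ?thesis using False by (simp add: subst_letter_def)
  qed (use gen[OF that] in \<open>simp add: subst_letter_def\<close>)
  from w show ?thesis
  proof (induction w)
    case Nil
    then show ?case using hom_one by (simp add: subst_word_def reduce_def)
  next
    case (Cons p w)
    obtain x b where p: "p = (x, b)" by fastforce
    from Cons.prems have x: "x \<in> X" and w: "w \<in> carrier (free_group X)"
      by (auto simp: words_over_def p dest: reduced_ConsD)
    have c: "[p] \<in> carrier (free_group X)"
      using x p by (simp add: words_over_def reduced_def)
    have "p # w = [p] \<otimes>\<^bsub>free_group X\<^esub> w"
      using Cons.prems by (simp add: reduce_id)
    then have "g (p # w) = reduce (g [p] @ g w)"
      using hom_mult[OF c w] by simp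
    then show ?case
      using Cons.IH[OF w] letter[OF x, of b] p by (simp add: subst_word_def)
  qed
qed

text \<open>\<open>hom_listed m n us g\<close>: the homomorphism \<open>g\<close> from the free group on \<open>{..<m}\<close> to the free
  group on \<open>{..<n}\<close> is given by the list \<open>us\<close> of words, not necessarily reduced, representing
  the images of the generators.\<close>

definition hom_listed :: "nat \<Rightarrow> nat \<Rightarrow> nat word list \<Rightarrow> (nat word \<Rightarrow> nat word) \<Rightarrow> bool" where
  "hom_listed m n us g \<longleftrightarrow>
     length us = m \<and> set us \<subseteq> words_over {..<n} \<and>
     g \<in> hom (free_group {..<m}) (free_group {..<n}) \<and>
     (\<forall>y<m. g [(y, True)] = reduce (us ! y))"

lemma hom_listed_exists:
  assumes "length us = m" "set us \<subseteq> words_over {..<n}"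
  shows "hom_listed m n us (subst_word (\<lambda>y. us ! y))"
proof -
  have "us ! y \<in> words_over {..<n}" if "y \<in> {..<m}" for y
    using assms that by (auto dest: nth_mem)
  then have "subst_word (\<lambda>y. us ! y) \<in> hom (free_group {..<m}) (free_group {..<n})"
    by (rule subst_word_hom)
  then show ?thesis
    using assms by (simp add: hom_listed_def subst_word_def subst_letter_def)
qed

lemma hom_listed_unique:
  assumes "hom_listed m n us g" "w \<in> carrier (free_group {..<m})"
  shows "g w = subst_word (\<lambda>y. us ! y) w"
  using assms by (intro hom_free_group_eq_subst_word) (auto simp: hom_listed_def)

definition equalizer :: "('a, 'c) monoid_scheme \<Rightarrow> ('a \<Rightarrow> 'b) \<Rightarrow> ('a \<Rightarrow> 'b) \<Rightarrow> 'a set" where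
  "equalizer G g h = {x \<in> carrier G. g x = h x}"

text \<open>Algorithms are partial recursive functions. \<open>Zero\<close> may be applied to any number of
  arguments. Recursion is on the first argument, and in the recursion step the counter and the
  previous value come first. \<open>computes f xs y\<close> means that \<open>f\<close> halts on \<open>xs\<close> with output \<open>y\<close>.\<close>

datatype recf = Zero | Succ | Proj nat | Comp recf "recf list" | PrimRec recf recf | Mu recf

inductive computes :: "recf \<Rightarrow> nat list \<Rightarrow> nat \<Rightarrow> bool" where
  zero: "computes Zero xs 0"
| succ: "computes Succ [x] (Suc x)"
| proj: "i < length xs \<Longrightarrow> computes (Proj i) xs (xs ! i)"
| comp: "list_all2 (\<lambda>g y. computes g xs y) gs ys \<Longrightarrow> computes f ys z \<Longrightarrow> computes (Comp f gs) xs z"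
| primrec_0: "computes f xs y \<Longrightarrow> computes (PrimRec f g) (0 # xs) y"
| primrec_Suc: "computes (PrimRec f g) (k # xs) r \<Longrightarrow> computes g (k # r # xs) y \<Longrightarrow>
    computes (PrimRec f g) (Suc k # xs) y"
| mu: "computes f (k # xs) 0 \<Longrightarrow> \<forall>i<k. \<exists>y>0. computes f (i # xs) y \<Longrightarrow> computes (Mu f) xs k"

theorem computes_deterministic: "computes f xs y \<Longrightarrow> computes f xs z \<Longrightarrow> y = z"
proof (induction arbitrary: z rule: computes.induct)
  case (comp xs gs ys f y)
  from comp.prems obtain zs where zs: "list_all2 (\<lambda>g y. computes g xs y) gs zs" "computes f zs z"
    by cases auto
  have "ys = zs"
    using comp.IH(1) zs(1) by (intro nth_equalityI) (auto simp: list_all2_conv_all_nth)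
  then show ?case using comp.IH(2) zs(2) by simp
next
  case (primrec_0 f xs y g)
  from primrec_0.prems show ?case by cases (use primrec_0.IH in auto)
next
  case (primrec_Suc f g k xs r y)
  from primrec_Suc.prems show ?case by cases (use primrec_Suc.IH in auto)
next
  case (mu f k xs)
  from mu.prems obtain
    k': "computes f (z # xs) 0" and less: "\<forall>i<z. \<exists>y>0. computes f (i # xs) y"
    by cases auto
  have "\<not> k < z" using mu.IH(1) less by (metis less_numeral_extra(3))
  moreover have "\<not> z < k" using mu.IH(2) k' by (metis less_numeral_extra(3))
  ultimately show ?case by simp
qed (auto elim: computes.cases)

definition letter_code :: "nat letter \<Rightarrow> nat" where
  "letter_code p = prod_encode (fst p, of_bool (snd p))"

definition word_code :: "nat word \<Rightarrow> nat" where
  "word_code w = list_encode (map letter_code w)"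

definition input_code :: "nat \<Rightarrow> nat \<Rightarrow> nat word list \<Rightarrow> nat word list \<Rightarrow> nat" where
  "input_code m n us vs =
     list_encode [m, n, list_encode (map word_code us), list_encode (map word_code vs)]"

end

theory Submission
  imports Defs "HOL-Library.Countable"
begin

text \<open>
  A permutation automaton with two states reading \<open>w\<close> and producing an output \<open>T w\<close> in the free
  group is the same thing as a pair \<open>g\<close>, \<open>h\<close> with \<open>h\<close> the inclusion of a subgroup of index two,
  and the equalizer consists of the \<open>w\<close> leading from the base state to itself with \<open>T w = w\<close>.
  Such \<open>w\<close> stabilise the vertex \<open>(1, base)\<close> under the action by which the letter \<open>a\<close> sends
  \<open>(u, q)\<close> to \<open>(a\<^sup>-\<^sup>1 u P\<^sub>q(a), q \<cdot> a)\<close>. Suppose that \<open>a\<close> does not occur in the positive word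
  \<open>P\<^sub>q(a)\<close>. Then exactly one end of each edge begins with the letter that is being removed; orient
  the edge away from that end. Every vertex has at most one outgoing edge, and from a positive
  vertex it is a step of a queue automaton: remove the first letter \<open>a\<close> and append \<open>P\<^sub>q(a)\<close>.
  The only exception is the start edge, with output \<open>0 # c\<close> for the letter \<open>0\<close>. Hence the
  stabiliser is nontrivial iff the queue automaton started with \<open>c\<close> runs into a cycle.

  The queue automaton simulates register machines: a register with value \<open>x\<close> is a run of
  \<open>2 ^ x\<close> equal letters. In one pass the letters of the tested register flip the state and every
  second one is dropped; this decrements the register, or else leaves the state flipped because
  the register is zero. In the next pass the state tells which branch to take. A clock register
  makes sure that only halting runs end in a cycle.

  Given a decision procedure, run a machine that reads the description of its own instance,
  builds the input code, asks the procedure, and halts iff the answer is no.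
\<close>

section \<open>Free groups and transducers\<close>

lemma reduce_cong:
  "reduce u = reduce u' \<Longrightarrow> reduce v = reduce v' \<Longrightarrow> reduce (u @ v) = reduce (u' @ v')"
  by (metis reduce_append_left reduce_append_right)

lemma reduce_append_middle [simp]: "reduce (u @ reduce v @ w) = reduce (u @ v @ w)"
  by (metis reduce_append_left reduce_append_right)

lemma inv_word_Nil [simp]: "inv_word [] = []"
  by (simp add: inv_word_def)

lemma inv_word_Cons: "inv_word (p # w) = inv_word w @ [inv_letter p]"
  by (simp add: inv_word_def)

lemma inv_word_append [simp]: "inv_word (u @ v) = inv_word v @ inv_word u"
  by (simp add: inv_word_def)

lemma reduce_Nil [simp]: "reduce [] = []"
  by (simp add: reduce_def)

lemma reduce_cancel_middle [simp]:
  "reduce (x @ w @ inv_word w @ y) = reduce (x @ y)"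
  "reduce (x @ inv_word w @ w @ y) = reduce (x @ y)"
  by (metis append_assoc append_Nil reduce_append_left reduce_append_right reduce_inv_word_right,
      metis append_assoc append_Nil reduce_append_left reduce_append_right reduce_inv_word_left)

lemma reduce_eq_iff: "reduce u = reduce v \<longleftrightarrow> reduce (inv_word u @ v) = []"
proof
  assume "reduce u = reduce v"
  then have "reduce (inv_word u @ v) = reduce (inv_word u @ u)"
    by (metis reduce_append_right)
  then show "reduce (inv_word u @ v) = []" by simp
next
  assume a: "reduce (inv_word u @ v) = []"
  have "reduce v = reduce (u @ reduce (inv_word u @ v))"
    using reduce_cancel_middle(1)[of "[]" u v] by simp
  then show "reduce u = reduce v" using a by simp
qed

lemma reduce_inv_word_cong:
  assumes "reduce u = reduce v"
  shows "reduce (inv_word u) = reduce (inv_word v)"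
proof -
  have "reduce (inv_word u) = reduce (inv_word u @ v @ inv_word v)"
    using reduce_cancel_middle(1)[of "inv_word u" v "[]"] by simp
  also have "\<dots> = reduce (inv_word u @ u @ inv_word v)"
    using assms by (intro reduce_cong) auto
  also have "\<dots> = reduce (inv_word v)"
    using reduce_cancel_middle(2)[of "[]" u "inv_word v"] by simp
  finally show ?thesis .
qed

lemma reduced_append_self_inverse:
  assumes "reduced (w @ inv_word w)"
  shows "w = []"
  using reduce_id[OF assms] by simp

lemma successively_append_left: "successively R (u @ v) \<Longrightarrow> successively R u"
  by (simp add: successively_append_iff)

lemma reduced_butlast: "reduced (w @ [p]) \<Longrightarrow> reduced w"
  unfolding reduced_def by (rule successively_append_left)

lemma reduced_snocD: "reduced (w @ [p, q]) \<Longrightarrow> q \<noteq> inv_letter p"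
  unfolding reduced_def by (simp add: successively_append_iff)

lemma reduced_snocI: "reduced w \<Longrightarrow> w = [] \<or> p \<noteq> inv_letter (last w) \<Longrightarrow> reduced (w @ [p])"
  unfolding reduced_def by (simp add: successively_append_iff)

lemma reduce_snoc:
  assumes "reduced w"
  shows "reduce (w @ [p]) = (if w \<noteq> [] \<and> p = inv_letter (last w) then butlast w else w @ [p])"
proof (cases "w \<noteq> [] \<and> p = inv_letter (last w)")
  case True
  then obtain w' q where w: "w = w' @ [q]" by (metis rev_exhaust)
  with True have "reduce (w @ [p]) = reduce (w' @ [q] @ inv_word [q] @ [])"
    by (simp add: inv_word_def)
  also have "\<dots> = reduce w'" by (simp only: reduce_cancel_middle) simp
  also have "\<dots> = w'" using assms w by (metis reduced_butlast reduce_id)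
  finally show ?thesis using True w by simp
next
  case False
  then show ?thesis using assms by (auto intro!: reduce_id reduced_snocI)
qed

text \<open>When the letters of \<open>v\<close> are appended one at a time, the head
  \<open>p\<close> can vanish only if \<open>inv_letter p\<close> arrives while the word is just
  \<open>[p]\<close>.\<close>

lemma reduce_append_keeps_head:
  assumes "reduced (p # w)" "inv_letter p \<notin> set v"
  shows "\<exists>w'. reduce (p # w @ v) = p # w'"
  using assms
proof (induction v arbitrary: w)
  case Nil
  then show ?case by (simp add: reduce_id)
next
  case (Cons q v)
  have "\<exists>w''. reduce ((p # w) @ [q]) = p # w''"
    using Cons.prems by (subst reduce_snoc) auto
  then obtain w'' where w'': "reduce (p # w @ [q]) = p # w''" by auto
  have "reduce (p # w @ q # v) = reduce (reduce (p # w @ [q]) @ v)"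
    by (simp only: reduce_append_left) simp
  also have "\<dots> = reduce (p # w'' @ v)" by (simp add: w'')
  finally show ?case
    using Cons.IH[of w''] Cons.prems(2) w'' by (metis list.set_intros(2) reduce_reduced)
qed

definition pos :: "'a list \<Rightarrow> 'a word" where
  "pos u = map (\<lambda>a. (a, True)) u"

lemma pos_simps [simp]:
  "pos [] = []" "pos (a # u) = (a, True) # pos u" "pos (u @ v) = pos u @ pos v"
  by (simp_all add: pos_def)

lemma set_pos: "set (pos u) = (\<lambda>a. (a, True)) ` set u"
  by (simp add: pos_def)

lemma pos_eq_iff [simp]: "pos u = pos v \<longleftrightarrow> u = v"
  by (simp add: pos_def inj_map_eq_map inj_def)

lemma reduced_pos: "reduced (pos u)"
proof (induction u)
  case (Cons a u)
  then show ?case by (cases u) (auto simp: reduced_def inv_letter_def)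
qed simp

lemma reduce_pos [simp]: "reduce (pos u) = pos u"
  by (simp add: reduce_id reduced_pos)

section \<open>Two-state transducers\<close>

fun state_after :: "('a \<Rightarrow> bool) \<Rightarrow> bool \<Rightarrow> 'a word \<Rightarrow> bool" where
  "state_after \<sigma> q [] = q"
| "state_after \<sigma> q (p # w) = state_after \<sigma> (q \<noteq> \<sigma> (fst p)) w"

text \<open>An inverse letter crosses an edge of the automaton backwards, so it emits the inverse of
  the output at the state where it arrives. A letter and its inverse change the state alike, because
  swapping two states is an involution.\<close>

fun transduce :: "('a \<Rightarrow> bool) \<Rightarrow> (bool \<Rightarrow> 'a \<Rightarrow> 'b word) \<Rightarrow> bool \<Rightarrow> 'a word \<Rightarrow> 'b word" where
  "transduce \<sigma> \<omega> q [] = []"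
| "transduce \<sigma> \<omega> q (p # w) =
     (if snd p then \<omega> q (fst p) else inv_word (\<omega> (q \<noteq> \<sigma> (fst p)) (fst p)))
       @ transduce \<sigma> \<omega> (q \<noteq> \<sigma> (fst p)) w"

lemma xor_cancel [simp]: "((q = (\<not> b)) = (\<not> b)) = q"
  by auto

lemma state_after_append [simp]:
  "state_after \<sigma> q (u @ v) = state_after \<sigma> (state_after \<sigma> q u) v"
  by (induction u arbitrary: q) auto

lemma transduce_append:
  "transduce \<sigma> \<omega> q (u @ v) = transduce \<sigma> \<omega> q u @ transduce \<sigma> \<omega> (state_after \<sigma> q u) v"
  by (induction u arbitrary: q) auto

lemma state_after_cancel_cons: "state_after \<sigma> q (cancel_cons p w) = state_after \<sigma> q (p # w)"
  by (cases w) (auto simp: inv_letter_def)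

text \<open>A cancelling pair crosses one edge forth and back, with mutually inverse outputs. Hence
  the output, as an element of the free group, depends only on the group element that is
  read.\<close>

lemma transduce_cancel_cons:
  "reduce (transduce \<sigma> \<omega> q (cancel_cons p w)) = reduce (transduce \<sigma> \<omega> q (p # w))"
proof (cases w)
  case (Cons p' v)
  show ?thesis
  proof (cases "p' = inv_letter p")
    case True
    then show ?thesis
      using Cons
        reduce_cancel_middle(1)[of "[]" "\<omega> q (fst p)" "transduce \<sigma> \<omega> q v"]
        reduce_cancel_middle(2)[of "[]" "\<omega> (q \<noteq> \<sigma> (fst p)) (fst p)" "transduce \<sigma> \<omega> q v"]
      by (auto simp: inv_letter_def)
  qed (use Cons in simp)
qed simp

lemma state_after_reduce [simp]: "state_after \<sigma> q (reduce w) = state_after \<sigma> q w"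
  by (induction w arbitrary: q) (simp_all add: reduce_def state_after_cancel_cons)

lemma transduce_reduce: "reduce (transduce \<sigma> \<omega> q (reduce w)) = reduce (transduce \<sigma> \<omega> q w)"
proof (induction w arbitrary: q)
  case (Cons p w)
  have "reduce (transduce \<sigma> \<omega> q (reduce (p # w))) = reduce (transduce \<sigma> \<omega> q (p # reduce w))"
    by (simp only: reduce_def foldr.simps o_apply transduce_cancel_cons[unfolded reduce_def])
  also have "\<dots> = reduce (transduce \<sigma> \<omega> q (p # w))"
    using Cons.IH by (auto intro: reduce_cong)
  finally show ?case .
qed simp

lemma state_after_inv_word [simp]:
  "state_after \<sigma> (state_after \<sigma> q w) (inv_word w) = q"
  by (induction w arbitrary: q) (auto simp: inv_word_Cons inv_letter_def)

lemma transduce_inv_word: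
  "transduce \<sigma> \<omega> (state_after \<sigma> q w) (inv_word w) = inv_word (transduce \<sigma> \<omega> q w)"
proof (induction w arbitrary: q)
  case (Cons p w)
  show ?case
    using Cons.IH[of "q \<noteq> \<sigma> (fst p)"]
      state_after_inv_word[of \<sigma> "q \<noteq> \<sigma> (fst p)" w]
    by (auto simp: inv_word_Cons transduce_append inv_letter_def)
qed simp

lemma state_after_concat_loops:
  assumes "\<And>p. p \<in> set y \<Longrightarrow> state_after \<sigma> q (f p) = q"
  shows "state_after \<sigma> q (concat (map f y)) = q"
  using assms by (induction y) auto

lemma transduce_concat_loops:
  assumes "\<And>p. p \<in> set y \<Longrightarrow> state_after \<sigma> q (f p) = q"
  shows "transduce \<sigma> \<omega> q (concat (map f y)) = concat (map (\<lambda>p. transduce \<sigma> \<omega> q (f p)) y)"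
  using assms by (induction y) (auto simp: transduce_append)

lemma transduce_words_over:
  assumes "\<And>q a. a \<in> A \<Longrightarrow> \<omega> q a \<in> words_over B" "w \<in> words_over A"
  shows "transduce \<sigma> \<omega> q w \<in> words_over B"
  using assms(2)
proof (induction w arbitrary: q)
  case (Cons p w)
  then have "fst p \<in> A" "w \<in> words_over A" by (auto simp: words_over_def)
  then show ?case
    using Cons.IH assms(1) by (auto simp: append_words_over inv_word_words_over)
qed (simp add: words_over_def)

section \<open>Substitutions and Schreier generators of the subgroup of index two\<close>

lemma subst_word_singleton: "subst_word (\<lambda>x. [(x, True)]) w = reduce w"
proof -
  have "concat (map (subst_letter (\<lambda>x. [(x, True)])) w) = w"
    by (induction w) (auto simp: subst_letter_def inv_word_def inv_letter_def)
  then show ?thesis by (simp add: subst_word_def)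
qed

lemma subst_word_cong:
  assumes "w \<in> words_over X" "\<And>x. x \<in> X \<Longrightarrow> \<phi> x = \<phi>' x"
  shows "subst_word \<phi> w = subst_word \<phi>' w"
proof -
  have "map (subst_letter \<phi>) w = map (subst_letter \<phi>') w"
    using assms by (auto simp: words_over_def subst_letter_def)
  then show ?thesis by (simp only: subst_word_def)
qed

lemma subst_word_inv_word: "subst_word \<phi> (inv_word w) = reduce (inv_word (subst_word \<phi> w))"
proof -
  have "concat (map (subst_letter \<phi>) (inv_word w)) = inv_word (concat (map (subst_letter \<phi>) w))"
    by (induction w) (auto simp: inv_word_Cons inv_letter_def subst_letter_def)
  then show ?thesis
    by (simp add: subst_word_def) (rule reduce_inv_word_cong, simp add: reduce_id)
qed

text \<open>The letter \<open>t\<close> is the spanning tree edge of the two-state automaton: it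
  swaps the states, and \<open>P_t\<close> makes the representative of the second coset emit
  nothing. \<open>P_no_self\<close> is what allows every edge to be oriented, the start edge being
  treated separately.\<close>

locale queue_transducer =
  fixes t :: nat and \<sigma> :: "nat \<Rightarrow> bool" and P :: "bool \<Rightarrow> nat \<Rightarrow> nat list" and c :: "nat list"
  assumes swap_t: "\<sigma> t" and P_t: "P True t = []"
    and P_range: "set (P q a) \<subseteq> {..t}"
    and P_start: "P False 0 = 0 # c" and start_notin: "0 \<notin> set c"
    and P_no_self: "a \<noteq> 0 \<or> q \<Longrightarrow> a \<notin> set (P q a)"
begin

abbreviation \<omega> :: "bool \<Rightarrow> nat \<Rightarrow> nat word" where
  "\<omega> q a \<equiv> pos (P q a)"

text \<open>A Schreier transversal for the words that return to state \<open>False\<close>: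
  \<open>rep q\<close> leads from \<open>False\<close> to \<open>q\<close>.\<close>

definition rep :: "bool \<Rightarrow> nat word" where
  "rep q = (if q then [(t, False)] else [])"

text \<open>The index \<open>i\<close> packs the state \<open>odd i\<close> and the letter
  \<open>i div 2\<close>. The last pair, \<open>i = 2 * t + 1\<close>, gives the trivial element,
  which leaves the \<open>2 * t + 1\<close> indices below it.\<close>

definition schreier_word :: "nat \<Rightarrow> nat word" where
  "schreier_word i = rep (odd i) @ [(i div 2, True)] @ inv_word (rep (odd i \<noteq> \<sigma> (i div 2)))"

text \<open>Reidemeister-Schreier rewriting: used as a transducer output, it translates a word into
  Schreier generators, the tree edge giving the empty word.\<close>

definition rewrite :: "bool \<Rightarrow> nat \<Rightarrow> nat word" where
  "rewrite q a = (if q \<and> a = t then [] else [(2 * a + of_bool q, True)])"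

lemma state_after_rep [simp]: "state_after \<sigma> False (rep q) = q"
  using swap_t by (simp add: rep_def)

lemma state_after_inv_rep [simp]: "state_after \<sigma> q (inv_word (rep q)) = False"
  using swap_t by (simp add: rep_def inv_word_def inv_letter_def)

lemma state_after_schreier_word: "state_after \<sigma> False (schreier_word i) = False"
  by (simp add: schreier_word_def)

lemma state_after_schreier_letter: "state_after \<sigma> False (subst_letter schreier_word p) = False"
  using state_after_inv_word[of \<sigma> False "schreier_word (fst p)"]
  by (simp add: subst_letter_def state_after_schreier_word)

lemma state_after_subst_schreier: "state_after \<sigma> False (subst_word schreier_word y) = False"
  by (simp add: subst_word_def state_after_concat_loops state_after_schreier_letter)

lemma transduce_schreier_word:
  assumes "\<eta> True t = []"
  shows "transduce \<sigma> \<eta> False (schreier_word i) = \<eta> (odd i) (i div 2)"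
  using swap_t assms
  by (auto simp: schreier_word_def transduce_append rep_def inv_word_def inv_letter_def)

text \<open>The output \<open>\<eta>\<close> is left open because two are needed: with
  \<open>\<omega>\<close> the lemma yields \<open>g\<close> from \<open>h\<close>, and with
  \<open>rewrite\<close> it yields a left inverse of \<open>h\<close>.\<close>

lemma transduce_subst_schreier:
  assumes "\<eta> True t = []"
  shows "reduce (transduce \<sigma> \<eta> False (subst_word schreier_word y))
       = subst_word (\<lambda>i. \<eta> (odd i) (i div 2)) y"
proof -
  have "transduce \<sigma> \<eta> False (subst_letter schreier_word p)
      = subst_letter (\<lambda>i. \<eta> (odd i) (i div 2)) p" for p
    using transduce_inv_word[of \<sigma> \<eta> False "schreier_word (fst p)"]
    by (simp add: subst_letter_def transduce_schreier_word[of \<eta>, OF assms] state_after_schreier_word)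
  then show ?thesis
    by (simp add: subst_word_def transduce_reduce transduce_concat_loops state_after_schreier_letter)
qed

lemma rewrite_subst_schreier:
  assumes "y \<in> words_over {..<2 * t + 1}"
  shows "reduce (transduce \<sigma> rewrite False (subst_word schreier_word y)) = reduce y"
proof -
  have "subst_word (\<lambda>i. rewrite (odd i) (i div 2)) y = subst_word (\<lambda>i. [(i, True)]) y"
  proof (rule subst_word_cong[OF assms])
    fix i assume "i \<in> {..<2 * t + 1}"
    then show "rewrite (odd i) (i div 2) = [(i, True)]"
      by (auto simp: rewrite_def)
  qed
  then show ?thesis
    by (simp add: transduce_subst_schreier rewrite_def subst_word_singleton)
qed

lemma rewrite_words_over:
  assumes "w \<in> words_over {..t}"
  shows "transduce \<sigma> rewrite q w \<in> words_over {..<2 * t + 1}"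
  using _ assms by (rule transduce_words_over) (auto simp: rewrite_def words_over_def)

lemma subst_schreier_rewrite_letter:
  "subst_word schreier_word (rewrite q a) = reduce (rep q @ [(a, True)] @ inv_word (rep (q \<noteq> \<sigma> a)))"
proof (cases "q \<and> a = t")
  case True
  then show ?thesis
    using swap_t reduce_inv_word_left[of "[(t, True)]"]
    by (simp add: rewrite_def rep_def subst_word_def inv_word_def inv_letter_def)
next
  case False
  then show ?thesis
    by (auto simp: rewrite_def subst_word_def subst_letter_def schreier_word_def)
qed

text \<open>Each letter contributes the representative of its source state, itself, and the inverse
  representative of its target state. Adjacent representatives cancel, and only the outer two
  remain.\<close>

lemma subst_schreier_rewrite:
  "subst_word schreier_word (transduce \<sigma> rewrite q w)
     = reduce (rep q @ w @ inv_word (rep (state_after \<sigma> q w)))"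
proof (induction w arbitrary: q)
  case Nil
  then show ?case by (simp add: subst_word_def)
next
  case (Cons p w)
  obtain a b where p: "p = (a, b)" by (cases p)
  let ?q = "q \<noteq> \<sigma> a"
  let ?o = "if b then rewrite q a else inv_word (rewrite ?q a)"
  have q: "(?q \<noteq> \<sigma> a) = q" by auto
  have o: "subst_word schreier_word ?o = reduce (rep q @ [p] @ inv_word (rep ?q))"
  proof (cases b)
    case True
    then show ?thesis using p by (simp add: subst_schreier_rewrite_letter)
  next
    case False
    have "subst_word schreier_word ?o
        = reduce (inv_word (reduce (rep ?q @ [(a, True)] @ inv_word (rep q))))"
      using False q by (simp add: subst_word_inv_word subst_schreier_rewrite_letter)
    also have "\<dots> = reduce (inv_word (rep ?q @ [(a, True)] @ inv_word (rep q)))"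
      by (rule reduce_inv_word_cong) (simp add: reduce_id)
    finally show ?thesis using False p by (simp add: inv_word_Cons inv_letter_def)
  qed
  have "subst_word schreier_word (transduce \<sigma> rewrite q (p # w))
      = reduce (reduce (rep q @ [p] @ inv_word (rep ?q))
          @ reduce (rep ?q @ w @ inv_word (rep (state_after \<sigma> ?q w))))"
    using Cons.IH[of ?q] o by (simp only: p subst_word_append transduce.simps fst_conv snd_conv)
  also have "\<dots> = reduce ((rep q @ [p]) @ inv_word (rep ?q) @ rep ?q
          @ (w @ inv_word (rep (state_after \<sigma> ?q w))))"
    by (simp only: reduce_append_left reduce_append_right append_assoc)
  finally show ?case by (simp only: reduce_cancel_middle) (simp add: p)
qed


section \<open>Action of words on the vertices\<close>

definition act :: "nat word \<times> bool \<Rightarrow> nat word \<Rightarrow> nat word \<times> bool" where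
  "act v w = (reduce (inv_word w @ fst v @ transduce \<sigma> \<omega> (snd v) w), state_after \<sigma> (snd v) w)"

lemma act_append: "act v (w @ w') = act (act v w) w'"
  by (simp add: act_def transduce_append)

lemma act_Cons: "act v (p # w) = act (act v [p]) w"
  using act_append[of v "[p]" w] by simp

lemma act_Nil: "reduced (fst v) \<Longrightarrow> act v [] = v"
  by (cases v) (simp add: act_def reduce_id)

lemma reduced_act [simp]: "reduced (fst (act v w))"
  by (simp add: act_def)

lemma act_inv_word:
  assumes "reduced (fst v)"
  shows "act (act v w) (inv_word w) = v"
proof -
  have "act (act v w) (inv_word w)
      = (reduce (w @ inv_word w @ fst v @ transduce \<sigma> \<omega> (snd v) w
           @ inv_word (transduce \<sigma> \<omega> (snd v) w)), snd v)"
    by (simp add: act_def transduce_append transduce_inv_word flip: act_append)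
  also have "\<dots> = v"
    using assms reduce_cancel_middle(1)[of "[]" w]
      reduce_cancel_middle(1)[of "fst v" "transduce \<sigma> \<omega> (snd v) w" "[]"]
    by (simp add: reduce_id)
  finally show ?thesis .
qed

lemma act_loop_iff:
  assumes "reduced w"
  shows "act ([], False) w = ([], False) \<longleftrightarrow>
     \<not> state_after \<sigma> False w \<and> reduce (transduce \<sigma> \<omega> False w) = w"
  using assms reduce_eq_iff[of w "transduce \<sigma> \<omega> False w"] by (auto simp: act_def reduce_id)

section \<open>Orientation of the edges and forward paths\<close>

definition forward :: "nat word \<times> bool \<Rightarrow> nat letter \<Rightarrow> bool" where
  "forward v p \<longleftrightarrow>
     fst v \<noteq> [] \<and> p = hd (fst v) \<or> fst v = [] \<and> \<not> snd v \<and> p = (0, True)"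

lemma forward_unique: "forward v p \<Longrightarrow> forward v p' \<Longrightarrow> p = p'"
  by (auto simp: forward_def)

text \<open>Away from the letter \<open>0\<close> in state \<open>False\<close>: if \<open>u\<close>
  does not begin with \<open>a\<close>, prefixing the inverse of \<open>a\<close> keeps the word
  reduced, and appending \<open>P q a\<close>, which has no \<open>a\<close>, cannot cancel that
  prefix. The reversed edge then removes the first letter at its source.\<close>

lemma edge_forward_True:
  assumes "reduced (fst v)"
  shows "forward v (a, True) \<or> forward (act v [(a, True)]) (a, False)"
proof (cases "forward v (a, True)")
  case False
  obtain u q where v: "v = (u, q)" by (cases v)
  let ?p = "(a, False) :: nat letter"
  have a: "inv_letter ?p = (a, True)" by (simp add: inv_letter_def)
  have red: "reduced (?p # u)"
    using assms False by (cases u) (auto simp: v reduced_def forward_def inv_letter_def)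
  have act: "fst (act v [(a, True)]) = reduce (?p # u @ \<omega> q a)"
    by (simp add: act_def v inv_word_def inv_letter_def)
  have "\<exists>w. reduce (?p # u @ \<omega> q a) = ?p # w"
  proof (cases "a = 0 \<and> \<not> q")
    case True
    \<comment> \<open>At the base vertex this edge is forward. For nonempty \<open>u\<close>, the
      leading \<open>0\<close> of the output cancels at most the last letter of \<open>u\<close>,
      and \<open>c\<close> contains no \<open>0\<close>, so the prefixed letter survives.\<close>
    then have "u \<noteq> []" using False by (auto simp: v forward_def)
    have "\<exists>w. reduced (?p # w) \<and> reduce ((?p # u) @ [(0, True)]) = ?p # w"
    proof (cases "last u = ?p")
      case True
      then have "reduce ((?p # u) @ [(0, True)]) = butlast (?p # u)"
        using red \<open>u \<noteq> []\<close> \<open>a = 0 \<and> \<not> q\<close> by (subst reduce_snoc) (auto simp: inv_letter_def)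
      then have "reduce ((?p # u) @ [(0, True)]) = ?p # butlast u" using \<open>u \<noteq> []\<close> by simp
      then show ?thesis by (metis reduce_reduced)
    next
      case False
      then have "reduce ((?p # u) @ [(0, True)]) = ?p # u @ [(0, True)]"
        using red \<open>u \<noteq> []\<close> \<open>a = 0 \<and> \<not> q\<close>
        by (subst reduce_snoc) (auto simp: inv_letter_def prod_eq_iff)
      then show ?thesis by (metis reduce_reduced)
    qed
    then obtain w where w: "reduced (?p # w)" "reduce (?p # u @ [(0, True)]) = ?p # w" by auto
    have "reduce (?p # u @ \<omega> q a) = reduce (reduce (?p # u @ [(0, True)]) @ pos c)"
      using True by (simp only: reduce_append_left) (simp add: P_start)
    also have "\<dots> = reduce (?p # w @ pos c)" by (simp add: w)
    finally show ?thesis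
      using reduce_append_keeps_head[OF w(1), of "pos c"] start_notin True
      by (auto simp: set_pos inv_letter_def image_iff)
  next
    case False
    then have "a \<notin> set (P q a)" using P_no_self by blast
    then show ?thesis
      using reduce_append_keeps_head[OF red, of "\<omega> q a"] by (auto simp: set_pos a)
  qed
  then show ?thesis using act by (auto simp: forward_def)
qed simp

lemma edge_forward:
  assumes "reduced (fst v)"
  shows "forward v p \<or> forward (act v [p]) (inv_letter p)"
proof (cases "snd p")
  case True
  then show ?thesis
    using edge_forward_True[OF assms, of "fst p"] by (cases p) (simp add: inv_letter_def)
next
  case False
  then have "act (act v [p]) [(fst p, True)] = v"
    using act_inv_word[OF assms, of "[p]"] by (simp add: inv_word_def inv_letter_def)
  then show ?thesis
    using edge_forward_True[of "act v [p]" "fst p"] False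
    by (cases p) (auto simp: inv_letter_def)
qed

fun forward_path :: "nat word \<times> bool \<Rightarrow> nat word \<Rightarrow> nat word \<times> bool \<Rightarrow> bool" where
  "forward_path v [] z \<longleftrightarrow> v = z"
| "forward_path v (p # w) z \<longleftrightarrow> forward v p \<and> forward_path (act v [p]) w z"

lemma forward_path_append:
  "forward_path v (w @ w') z \<longleftrightarrow> (\<exists>y. forward_path v w y \<and> forward_path y w' z)"
  by (induction w arbitrary: v) auto

lemma forward_path_act:
  "forward_path v w z \<Longrightarrow> reduced (fst v) \<Longrightarrow> z = act v w"
proof (induction w arbitrary: v)
  case (Cons p w)
  then show ?case using act_Cons[of v p w] by simp
qed (simp add: act_Nil)

text \<open>Forward edges are unique, so two forward paths from one vertex run together until the
  shorter one ends.\<close>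

lemma forward_path_prefix:
  assumes "forward_path v w z" "forward_path v w' z'" "length w \<le> length w'"
  shows "\<exists>k. w' = w @ k \<and> forward_path z k z'"
  using assms
proof (induction w arbitrary: v w')
  case (Cons p w)
  then obtain p' w'' where "w' = p' # w''" by (cases w') auto
  with Cons.prems have "p' = p" "forward_path (act v [p]) w'' z'"
    by (auto dest: forward_unique)
  then show ?case
    using Cons.IH[of "act v [p]" w''] Cons.prems(1,3) \<open>w' = p' # w''\<close> by simp
qed simp

text \<open>A reduced path cannot follow a forward edge after a backward one, since the forward edge
  out of a vertex is unique.\<close>

lemma reduced_path_shape:
  assumes "reduced (fst x)" "reduced w"
  shows "\<exists>l k z. w = l @ inv_word k \<and> forward_path x l z \<and> forward_path (act x w) k z"
  using assms(2)
proof (induction w rule: rev_induct)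
  case Nil
  show ?case using assms(1) by (intro exI[of _ "[]"]) (simp add: act_Nil)
next
  case (snoc p w)
  then obtain l k z where IH: "w = l @ inv_word k" "forward_path x l z" "forward_path (act x w) k z"
    using reduced_butlast by blast
  let ?v = "act x w"
  have v': "act x (w @ [p]) = act ?v [p]" by (rule act_append)
  show ?case
  proof (cases "forward ?v p")
    case True
    have "k = []"
    proof (cases k)
      case (Cons p' k')
      then have "forward ?v p'" using IH(3) by simp
      then have "p' = p" using True by (rule forward_unique)
      then have "w @ [p] = (l @ inv_word k') @ [inv_letter p, p]"
        using IH(1) Cons by (simp add: inv_word_Cons)
      then show ?thesis using snoc.prems reduced_snocD[of "l @ inv_word k'" "inv_letter p" p] by simp
    qed
    then have "w = l" "z = ?v" using IH by auto
    then have "w @ [p] = (l @ [p]) @ inv_word []" "forward_path x (l @ [p]) (act x (w @ [p]))"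
      using IH(2) True v' by (simp, metis forward_path.simps forward_path_append)
    then show ?thesis by (metis forward_path.simps(1))
  next
    case False
    then have "forward (act ?v [p]) (inv_letter p)"
      using edge_forward[of ?v p] by auto
    moreover have "act (act ?v [p]) [inv_letter p] = ?v"
      using act_inv_word[of ?v "[p]"] by (simp add: inv_word_def)
    ultimately have "forward_path (act x (w @ [p])) (inv_letter p # k) z"
      using IH(3) v' by simp
    moreover have "w @ [p] = l @ inv_word (inv_letter p # k)"
      using IH(1) by (simp add: inv_word_Cons)
    ultimately show ?thesis using IH(2) by blast
  qed
qed

lemma forward_path_words_over:
  assumes "forward_path v w z" "fst v \<in> words_over {..t}"
  shows "w \<in> words_over {..t} \<and> fst z \<in> words_over {..t}"
  using assms
proof (induction w arbitrary: v)
  case (Cons p w)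
  have p: "[p] \<in> words_over {..t}"
    using Cons.prems by (cases "fst v") (auto simp: forward_def words_over_def)
  have "transduce \<sigma> \<omega> (snd v) [p] \<in> words_over {..t}"
    using _ p
  proof (rule transduce_words_over)
    show "\<omega> q a \<in> words_over {..t}" for q a
      using P_range[of q a] by (auto simp: words_over_def set_pos)
  qed
  then have "fst (act v [p]) \<in> words_over {..t}"
    unfolding act_def fst_conv using Cons.prems(2) p
    by (intro reduce_words_over) (simp add: append_words_over inv_word_words_over)
  then have "w \<in> words_over {..t} \<and> fst z \<in> words_over {..t}"
    using Cons.IH[of "act v [p]"] Cons.prems(1) by simp
  then show ?case using p by (simp add: words_over_def)
qed (simp, simp add: words_over_def)

section \<open>Positive words and cycles of forward edges\<close>

definition positive :: "nat word \<Rightarrow> bool" where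
  "positive u \<longleftrightarrow> (\<exists>v. u = pos v)"

lemma forward_path_positive:
  assumes "forward_path v w z" "positive (fst v)"
  shows "positive w \<and> positive (fst z)"
  using assms
proof (induction w arbitrary: v)
  case (Cons p w)
  then obtain u where u: "fst v = pos u" and fw: "forward v p" by (auto simp: positive_def)
  have "\<exists>a. p = (a, True) \<and> positive (fst (act v [p]))"
  proof (cases u)
    case Nil
    then have "p = (0, True)" "\<not> snd v" using fw u by (auto simp: forward_def)
    moreover from this have "fst (act v [p]) = reduce ([] @ inv_word [(0, True)] @ [(0, True)] @ pos c)"
      using u Nil by (simp add: act_def P_start)
    then have "fst (act v [p]) = pos c" by (simp only: reduce_cancel_middle) simp
    ultimately show ?thesis by (auto simp: positive_def)
  next
    case (Cons a u')
    then have "p = (a, True)" using fw u by (auto simp: forward_def)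
    moreover from this have "fst (act v [p])
        = reduce ([] @ inv_word [(a, True)] @ [(a, True)] @ (pos (u' @ P (snd v) a)))"
      using u Cons by (simp add: act_def)
    then have "fst (act v [p]) = pos (u' @ P (snd v) a)"
      by (simp only: reduce_cancel_middle) (simp del: pos_simps)
    ultimately show ?thesis unfolding positive_def by blast
  qed
  then show ?case using Cons.IH[of "act v [p]"] Cons.prems by (auto simp: positive_def intro: pos_simps(2)[symmetric])
qed (auto simp: positive_def intro: exI[of _ "[]"])

definition reaches_cycle :: bool where
  "reaches_cycle \<longleftrightarrow>
     (\<exists>l k z. forward_path ([], False) l z \<and> k \<noteq> [] \<and> forward_path z k z)"

text \<open>A reduced loop splits into \<open>l\<close> and the inverse of \<open>k\<close>, two
  forward paths from the base to a common end. They differ, since otherwise the loop would be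
  trivial, so the longer one leaves that end and returns to it.\<close>

lemma loop_iff_reaches_cycle:
  "(\<exists>w\<in>words_over {..t}. reduced w \<and> w \<noteq> [] \<and> act ([], False) w = ([], False)) \<longleftrightarrow> reaches_cycle"
proof
  assume "\<exists>w\<in>words_over {..t}. reduced w \<and> w \<noteq> [] \<and> act ([], False) w = ([], False)"
  then obtain w where w: "reduced w" "w \<noteq> []" "act ([], False) w = ([], False)" by blast
  then obtain l k z where
    lk: "w = l @ inv_word k" "forward_path ([], False) l z" "forward_path ([], False) k z"
    using reduced_path_shape[of "([], False)" w] by auto
  have ne: "l \<noteq> k" using w lk(1) reduced_append_self_inverse[of k] by auto
  show reaches_cycle
  proof (cases "length l \<le> length k")
    case True
    then show ?thesis
      using forward_path_prefix[OF lk(2,3)] lk(2) ne unfolding reaches_cycle_def by fastforce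
  next
    case False
    then show ?thesis
      using forward_path_prefix[OF lk(3,2)] lk(3) ne unfolding reaches_cycle_def by fastforce
  qed
next
  assume reaches_cycle
  then obtain l k z where
    lk: "forward_path ([], False) l z" "k \<noteq> []" "forward_path z k z"
    unfolding reaches_cycle_def by blast
  have pz: "positive (fst z)"
    using forward_path_positive[OF lk(1)] pos_simps(1) unfolding positive_def by (metis fst_conv)
  then have "positive k" using forward_path_positive[OF lk(3)] by blast
  then obtain k' where k': "k = pos k'" unfolding positive_def by blast
  have rz: "reduced (fst z)" using pz by (auto simp: positive_def reduced_pos)
  have z: "z = act ([], False) l" "z = act z k"
    using forward_path_act[OF lk(1)] forward_path_act[OF lk(3) rz] by auto
  \<comment> \<open>The cycle is conjugated back to the base along \<open>l\<close>. The result is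
    nontrivial because \<open>k\<close> is a nonempty positive word, which reduction leaves
    unchanged.\<close>
  let ?w = "l @ k @ inv_word l"
  have "act ([], False) ?w = ([], False)"
    using z act_inv_word[of "([], False)" l] by (metis act_append fst_conv reduced_Nil)
  then have "act ([], False) (reduce ?w) = ([], False)"
  proof -
    have "act v (reduce w) = act v w" for v w
      by (simp add: act_def) (intro reduce_cong reduce_inv_word_cong transduce_reduce refl, simp add: reduce_id)
    then show "act ([], False) ?w = ([], False) \<Longrightarrow> ?thesis" by simp
  qed
  moreover have "reduce ?w \<noteq> []"
  proof
    assume "reduce ?w = []"
    have "reduce k = reduce (inv_word l @ l @ k @ inv_word l @ l)"
      using reduce_cancel_middle(2)[of "[]" l] reduce_cancel_middle(2)[of k l "[]"] by simp
    also have "\<dots> = reduce (inv_word l @ reduce ?w @ l)" by simp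
    also have "\<dots> = []" using \<open>reduce ?w = []\<close> by simp
    finally show False using k' lk(2) by simp
  qed
  moreover have "reduce ?w \<in> words_over {..t}"
  proof -
    have "[] \<in> words_over {..t}" by (simp add: words_over_def)
    then have "l \<in> words_over {..t}" "fst z \<in> words_over {..t}"
      using forward_path_words_over[OF lk(1)] by auto
    then show ?thesis
      using forward_path_words_over[OF lk(3)]
      by (simp add: reduce_words_over append_words_over inv_word_words_over)
  qed
  ultimately show "\<exists>w\<in>words_over {..t}. reduced w \<and> w \<noteq> [] \<and> act ([], False) w = ([], False)"
    by (intro bexI[of _ "reduce ?w"] conjI reduce_reduced)
qed

section \<open>The queue automaton\<close>

inductive queue_step :: "nat list \<times> bool \<Rightarrow> nat list \<times> bool \<Rightarrow> bool" where
  read: "queue_step (a # u, q) (u @ P q a, q \<noteq> \<sigma> a)"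
| start: "queue_step ([], False) (c, \<sigma> 0)"

lemma queue_step_deterministic: "queue_step x y \<Longrightarrow> queue_step x z \<Longrightarrow> y = z"
  by (auto elim!: queue_step.cases)

abbreviation pos_vertex :: "nat list \<times> bool \<Rightarrow> nat word \<times> bool" where
  "pos_vertex x \<equiv> (pos (fst x), snd x)"

text \<open>On the start edge the removed letter \<open>0\<close> cancels against the leading
  \<open>0\<close> of \<open>P False 0\<close>, so only \<open>c\<close> is left.\<close>

lemma act_forward_pos:
  "act (pos (a # u), q) [(a, True)] = (pos (u @ P q a), q \<noteq> \<sigma> a)"
  "act ([], False) [(0, True)] = (pos c, \<sigma> 0)"
proof -
  show "act (pos (a # u), q) [(a, True)] = (pos (u @ P q a), q \<noteq> \<sigma> a)"
    using reduce_cancel_middle(2)[of "[]" "[(a, True)]" "pos (u @ P q a)"]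
    by (simp add: act_def del: pos_simps(3)) simp
  show "act ([], False) [(0, True)] = (pos c, \<sigma> 0)"
    using reduce_cancel_middle(2)[of "[]" "[(0, True)]" "pos c"]
    by (simp add: act_def P_start)
qed

lemma forward_edge_iff_queue_step:
  "(\<exists>p. forward (pos_vertex x) p \<and> act (pos_vertex x) [p] = z) \<longleftrightarrow>
     (\<exists>y. z = pos_vertex y \<and> queue_step x y)"
proof (cases x)
  case (Pair u q)
  show ?thesis
  proof (cases u)
    case Nil
    then show ?thesis
      using Pair act_forward_pos(2)
      by (cases q) (auto simp: forward_def queue_step.simps)
  next
    case (Cons a u')
    then show ?thesis
      using Pair act_forward_pos(1)[of a u' q] queue_step.read[of a u' q]
      by (auto simp: forward_def queue_step.simps simp del: pos_simps(3))
  qed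
qed

text \<open>Counting steps by path length lets nonempty cycles correspond to a positive number of
  queue steps.\<close>

lemma forward_path_iff_queue_steps:
  "(\<exists>w. length w = n \<and> forward_path (pos_vertex x) w z) \<longleftrightarrow>
     (\<exists>y. z = pos_vertex y \<and> (queue_step ^^ n) x y)"
proof (induction n arbitrary: x)
  case (Suc n)
  have "(\<exists>w. length w = Suc n \<and> forward_path (pos_vertex x) w z) \<longleftrightarrow>
     (\<exists>v. (\<exists>p. forward (pos_vertex x) p \<and> act (pos_vertex x) [p] = v) \<and>
        (\<exists>w. length w = n \<and> forward_path v w z))"
    by (simp only: length_Suc_conv ex_simps[symmetric] forward_path.simps) (metis forward_path.simps(2))
  also have "\<dots> \<longleftrightarrow> (\<exists>x'. queue_step x x' \<and>
        (\<exists>w. length w = n \<and> forward_path (pos_vertex x') w z))"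
    by (simp only: forward_edge_iff_queue_step) blast
  also have "\<dots> \<longleftrightarrow> (\<exists>x'. queue_step x x' \<and> (\<exists>y. z = pos_vertex y \<and> (queue_step ^^ n) x' y))"
    by (simp only: Suc.IH)
  also have "\<dots> \<longleftrightarrow> (\<exists>y. z = pos_vertex y \<and> (queue_step ^^ Suc n) x y)"
    by (simp only: relpowp_Suc_right[symmetric] relpowp_Suc_left) (auto simp: OO_def)
  finally show ?case .
qed auto

lemma reaches_cycle_iff_queue:
  "reaches_cycle \<longleftrightarrow> (\<exists>x. queue_step\<^sup>*\<^sup>* ([], False) x \<and> queue_step\<^sup>+\<^sup>+ x x)"
proof
  assume reaches_cycle
  then obtain l k z where
    lk: "forward_path (pos_vertex ([], False)) l z" "k \<noteq> []" "forward_path z k z"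
    unfolding reaches_cycle_def by auto
  then obtain x where x: "z = pos_vertex x" "(queue_step ^^ length l) ([], False) x"
    using forward_path_iff_queue_steps by blast
  with lk(3) obtain y where "z = pos_vertex y" "(queue_step ^^ length k) x y"
    using forward_path_iff_queue_steps by blast
  moreover from this have "x = y" using x(1) by (auto intro!: prod_eqI)
  ultimately have "(queue_step ^^ length k) x x" by simp
  then show "\<exists>x. queue_step\<^sup>*\<^sup>* ([], False) x \<and> queue_step\<^sup>+\<^sup>+ x x"
    using x(2) lk(2) by (metis length_greater_0_conv relpowp_imp_rtranclp tranclp_power)
next
  assume "\<exists>x. queue_step\<^sup>*\<^sup>* ([], False) x \<and> queue_step\<^sup>+\<^sup>+ x x"
  then obtain x m n where *: "(queue_step ^^ m) ([], False) x" "0 < n" "(queue_step ^^ n) x x"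
    by (metis rtranclp_imp_relpowp tranclp_power)
  from *(1) obtain l where "forward_path (pos_vertex ([], False)) l (pos_vertex x)"
    using forward_path_iff_queue_steps[of m "([], False)"] by blast
  moreover from *(3) obtain k where "length k = n" "forward_path (pos_vertex x) k (pos_vertex x)"
    using forward_path_iff_queue_steps[of n x] by blast
  ultimately show reaches_cycle
    using \<open>0 < n\<close> unfolding reaches_cycle_def by fastforce
qed

section \<open>The homomorphisms \<open>g\<close> and \<open>h\<close> and their equalizer\<close>

abbreviation generator_images :: "nat word list" where
  "generator_images \<equiv> map schreier_word [0..<2 * t + 1]"

abbreviation output_images :: "nat word list" where
  "output_images \<equiv> map (\<lambda>i. \<omega> (odd i) (i div 2)) [0..<2 * t + 1]"

lemma generator_images_words_over: "set generator_images \<subseteq> words_over {..<t + 1}"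
  by (auto simp: schreier_word_def rep_def words_over_def inv_word_def inv_letter_def)

lemma output_images_words_over: "set output_images \<subseteq> words_over {..<t + 1}"
proof -
  have "\<omega> q a \<in> words_over {..<t + 1}" for q a
    using P_range[of q a] by (auto simp: words_over_def set_pos)
  then show ?thesis by (simp add: image_subset_iff del: upt_Suc)
qed

lemma subst_word_schreier_nth:
  "w \<in> words_over {..<2 * t + 1} \<Longrightarrow> subst_word (\<lambda>y. generator_images ! y) w = subst_word schreier_word w"
  by (erule subst_word_cong) (simp del: upt_Suc)

lemma subst_word_output_nth:
  "w \<in> words_over {..<2 * t + 1} \<Longrightarrow>
     subst_word (\<lambda>y. output_images ! y) w = subst_word (\<lambda>i. \<omega> (odd i) (i div 2)) w"
  by (erule subst_word_cong) (simp del: upt_Suc)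

context
  fixes g h
  assumes g: "hom_listed (2 * t + 1) (t + 1) output_images g"
    and h: "hom_listed (2 * t + 1) (t + 1) generator_images h"
begin

lemma h_eq: "y \<in> carrier (free_group {..<2 * t + 1}) \<Longrightarrow> h y = subst_word schreier_word y"
  using hom_listed_unique[OF h] subst_word_schreier_nth by simp

lemma g_eq:
  "y \<in> carrier (free_group {..<2 * t + 1}) \<Longrightarrow> g y = reduce (transduce \<sigma> \<omega> False (h y))"
  using hom_listed_unique[OF g, of y] subst_word_output_nth transduce_subst_schreier[of \<omega> y] h_eq
  by (simp add: P_t)

lemma rewrite_h:
  "y \<in> carrier (free_group {..<2 * t + 1}) \<Longrightarrow> reduce (transduce \<sigma> rewrite False (h y)) = y"
  using h_eq rewrite_subst_schreier by (simp add: reduce_id)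

lemma h_rewrite:
  assumes "w \<in> carrier (free_group {..<t + 1})"
  defines "y \<equiv> reduce (transduce \<sigma> rewrite False w)"
  shows "y \<in> carrier (free_group {..<2 * t + 1})"
    and "h y = reduce (w @ inv_word (rep (state_after \<sigma> False w)))"
proof -
  have "w \<in> words_over {..t}" using assms by (simp add: lessThan_Suc_atMost)
  then show c: "y \<in> carrier (free_group {..<2 * t + 1})"
    unfolding y_def using rewrite_words_over[of w False] reduce_words_over by simp
  show "h y = reduce (w @ inv_word (rep (state_after \<sigma> False w)))"
    using h_eq[OF c] by (simp add: y_def subst_word_reduce subst_schreier_rewrite) (simp add: rep_def)
qed

lemma inj_on_h: "inj_on h (carrier (free_group {..<2 * t + 1}))"
  by (rule inj_on_inverseI) (rule rewrite_h)

text \<open>The state reached by \<open>w\<close> selects its coset: by rewriting, \<open>w\<close>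
  is an image under \<open>h\<close> times the representative of that state, so two cosets
  suffice.\<close>

lemma finite_rcosets_h:
  "finite (rcosets\<^bsub>free_group {..<t + 1}\<^esub> (h ` carrier (free_group {..<2 * t + 1})))"
proof -
  let ?G = "free_group {..<t + 1}" and ?H = "h ` carrier (free_group {..<2 * t + 1})"
  interpret G: group ?G by (rule group_free_group)
  interpret F: group "free_group {..<2 * t + 1}" by (rule group_free_group)
  interpret group_hom "free_group {..<2 * t + 1}" ?G h
    using h by unfold_locales (simp add: hom_listed_def)
  have sub: "subgroup ?H ?G" by (rule img_is_subgroup)
  have "?H #>\<^bsub>?G\<^esub> w \<in> (\<lambda>q. ?H #>\<^bsub>?G\<^esub> rep q) ` UNIV" if w: "w \<in> carrier ?G" for w
  proof -
    let ?r = "rep (state_after \<sigma> False w)"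
    let ?y = "reduce (transduce \<sigma> rewrite False w)"
    have r: "?r \<in> carrier ?G"
      by (simp add: rep_def words_over_def reduced_def)
    have "h ?y \<otimes>\<^bsub>?G\<^esub> ?r = w"
      using h_rewrite(2)[OF w] w reduce_cancel_middle(2)[of w ?r "[]"] by (simp add: reduce_id)
    moreover have "h ?y \<in> ?H" using h_rewrite(1)[OF w] by blast
    ultimately have "w \<in> ?H #>\<^bsub>?G\<^esub> ?r" unfolding r_coset_def by force
    then show ?thesis using G.repr_independence[OF _ r sub] by blast
  qed
  then have "rcosets\<^bsub>?G\<^esub> ?H \<subseteq> (\<lambda>q. ?H #>\<^bsub>?G\<^esub> rep q) ` UNIV"
    unfolding RCOSETS_def by blast
  then show ?thesis by (rule finite_subset) simp
qed

lemma equalizer_nontrivial_iff: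
  "equalizer (free_group {..<2 * t + 1}) g h \<noteq> {\<one>\<^bsub>free_group {..<2 * t + 1}\<^esub>} \<longleftrightarrow> reaches_cycle"
proof -
  let ?Y = "carrier (free_group {..<2 * t + 1})"
  have one: "[] \<in> ?Y" by (simp add: words_over_def)
  have h1: "h [] = []" using h_eq[OF one] by (simp add: subst_word_def)
  let ?E = "equalizer (free_group {..<2 * t + 1}) g h"
  have "[] \<in> ?E" "\<And>y. y \<in> ?E \<longleftrightarrow> y \<in> ?Y \<and> g y = h y"
    using one h1 g_eq[OF one] unfolding equalizer_def by simp_all
  then have "?E \<noteq> {[]} \<longleftrightarrow> (\<exists>y\<in>?Y. y \<noteq> [] \<and> g y = h y)" by blast
  also have "\<dots> \<longleftrightarrow> (\<exists>w\<in>words_over {..t}. reduced w \<and> w \<noteq> [] \<and> act ([], False) w = ([], False))"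
  proof
    assume "\<exists>y\<in>?Y. y \<noteq> [] \<and> g y = h y"
    then obtain y where y: "y \<in> ?Y" "y \<noteq> []" "g y = h y" by blast
    have r: "reduced (h y)" using h_eq[OF y(1)] by (simp add: subst_word_def)
    have "h y \<noteq> []" using inj_onD[OF inj_on_h _ y(1) one] h1 y(2) by auto
    moreover have "\<not> state_after \<sigma> False (h y)"
      using h_eq[OF y(1)] state_after_subst_schreier by simp
    moreover have "h y \<in> words_over {..t}"
      using h y(1) by (auto simp: hom_listed_def lessThan_Suc_atMost dest!: hom_in_carrier)
    ultimately show "\<exists>w\<in>words_over {..t}. reduced w \<and> w \<noteq> [] \<and> act ([], False) w = ([], False)"
      using y(3) g_eq[OF y(1)] act_loop_iff[OF r] r by auto
  next
    assume "\<exists>w\<in>words_over {..t}. reduced w \<and> w \<noteq> [] \<and> act ([], False) w = ([], False)"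
    then obtain w where w: "w \<in> words_over {..t}" "reduced w" "w \<noteq> []" "\<not> state_after \<sigma> False w"
      "reduce (transduce \<sigma> \<omega> False w) = w"
      using act_loop_iff by blast
    then have wG: "w \<in> carrier (free_group {..<t + 1})" by (simp add: lessThan_Suc_atMost)
    \<comment> \<open>Rewriting gives a preimage under \<open>h\<close>: since \<open>w\<close>
      returns to state \<open>False\<close>, the correcting representative is empty.\<close>
    let ?y = "reduce (transduce \<sigma> rewrite False w)"
    have yY: "?y \<in> ?Y" by (rule h_rewrite(1)[OF wG])
    have hy: "h ?y = w"
      using h_rewrite(2)[OF wG] w by (simp add: rep_def reduce_id)
    have "g ?y = h ?y" using g_eq[OF yY] hy w by simp
    moreover have "?y \<noteq> []" using hy w(3) h1 by auto
    ultimately show "\<exists>y\<in>?Y. y \<noteq> [] \<and> g y = h y"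
      using yY by blast
  qed
  also have "\<dots> \<longleftrightarrow> reaches_cycle" by (rule loop_iff_reaches_cycle)
  finally show ?thesis by (simp only: free_group_simps)
qed

end

end

section \<open>Register programs\<close>

datatype com = Skip | Inc nat | Seq com com | Loop nat com

instance com :: countable
  by countable_datatype

text \<open>A control point is the stack of commands still to be run. The parts of a step are
  separated because the queue tests and decrements in one pass, and increments and jumps in the
  next.\<close>

fun tests :: "com list \<Rightarrow> nat \<Rightarrow> bool" where
  "tests (Loop r c # K) j \<longleftrightarrow> j = r"
| "tests K j \<longleftrightarrow> False"

fun incs :: "com list \<Rightarrow> nat \<Rightarrow> bool" where
  "incs (Inc r # K) j \<longleftrightarrow> j = r"
| "incs K j \<longleftrightarrow> False"

fun next_point :: "com list \<Rightarrow> bool \<Rightarrow> com list" where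
  "next_point [] z = []"
| "next_point (Skip # K) z = K"
| "next_point (Inc r # K) z = K"
| "next_point (Seq c1 c2 # K) z = c1 # c2 # K"
| "next_point (Loop r c # K) z = (if z then K else c # Loop r c # K)"

definition test_fails :: "com list \<Rightarrow> (nat \<Rightarrow> nat) \<Rightarrow> bool" where
  "test_fails p s \<longleftrightarrow> (\<exists>j. tests p j \<and> s j = 0)"

text \<open>Truncated subtraction leaves the tested register alone when it is already zero.\<close>

definition update :: "com list \<Rightarrow> (nat \<Rightarrow> nat) \<Rightarrow> nat \<Rightarrow> nat" where
  "update p s = (\<lambda>j. s j - of_bool (tests p j) + of_bool (incs p j))"

definition step :: "com list \<times> (nat \<Rightarrow> nat) \<Rightarrow> com list \<times> (nat \<Rightarrow> nat)" where
  "step x = (next_point (fst x) (test_fails (fst x) (snd x)), update (fst x) (snd x))"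

lemma step_simps [simp]:
  "step ([], s) = ([], s)"
  "step (Skip # K, s) = (K, s)"
  "step (Inc r # K, s) = (K, s(r := Suc (s r)))"
  "step (Seq c1 c2 # K, s) = (c1 # c2 # K, s)"
  "step (Loop r c # K, s) = (if s r = 0 then (K, s) else (c # Loop r c # K, s(r := s r - 1)))"
  by (auto simp: step_def update_def test_fails_def)

text \<open>\<open>K\<close> is generic for the induction: the first part of a sequence runs on top
  of the second, and a loop body on top of the loop itself. The finiteness makes the queue alphabet
  finite.\<close>

lemma finite_points:
  "\<exists>S. finite S \<and> c # K \<in> S \<and> (\<forall>p\<in>S. \<forall>z. next_point p z \<in> insert K S)"
proof (induction c arbitrary: K)
  case Skip
  show ?case by (intro exI[of _ "{Skip # K}"]) simp
next
  case (Inc r)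
  show ?case by (intro exI[of _ "{Inc r # K}"]) simp
next
  case (Seq c1 c2)
  obtain S2 where "finite S2" "c2 # K \<in> S2" "\<forall>p\<in>S2. \<forall>z. next_point p z \<in> insert K S2"
    using Seq.IH(2)[of K] by blast
  moreover obtain S1 where "finite S1" "c1 # c2 # K \<in> S1"
    "\<forall>p\<in>S1. \<forall>z. next_point p z \<in> insert (c2 # K) S1"
    using Seq.IH(1)[of "c2 # K"] by blast
  ultimately show ?case
    by (intro exI[of _ "insert (Seq c1 c2 # K) (S1 \<union> S2)"]) (auto, metis)
next
  case (Loop r c)
  obtain S where "finite S" "c # Loop r c # K \<in> S"
    "\<forall>p\<in>S. \<forall>z. next_point p z \<in> insert (Loop r c # K) S"
    using Loop.IH[of "Loop r c # K"] by blast
  then show ?case by (intro exI[of _ "insert (Loop r c # K) S"]) auto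
qed

text \<open>Quantifying over the stack \<open>K\<close> below the command makes runs composable in
  sequences and loops.\<close>

definition exec :: "com \<Rightarrow> (nat \<Rightarrow> nat) \<Rightarrow> (nat \<Rightarrow> nat) \<Rightarrow> bool" where
  "exec c s s' \<longleftrightarrow> (\<forall>K. \<exists>n. (step ^^ n) (c # K, s) = (K, s'))"

lemma exec_step: "(\<And>K. step (c # K, s) = (K, s')) \<Longrightarrow> exec c s s'"
  unfolding exec_def by (intro allI exI[of _ 1]) simp

lemma exec_Skip: "exec Skip s s"
  by (rule exec_step) simp

lemma exec_Inc: "exec (Inc r) s (s(r := Suc (s r)))"
  by (rule exec_step) simp

lemma exec_Loop_0: "s r = 0 \<Longrightarrow> exec (Loop r c) s s"
  by (rule exec_step) simp

lemma funpow_trans: "(f ^^ m) x = y \<Longrightarrow> (f ^^ n) y = z \<Longrightarrow> (f ^^ (n + m)) x = z"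
  by (simp add: funpow_add)

lemma exec_Seq:
  assumes "exec c1 s s'" "exec c2 s' s''"
  shows "exec (Seq c1 c2) s s''"
  unfolding exec_def
proof
  fix K
  obtain m n where "(step ^^ m) (c1 # c2 # K, s) = (c2 # K, s')" "(step ^^ n) (c2 # K, s') = (K, s'')"
    using assms unfolding exec_def by blast
  then have "(step ^^ (n + m)) (step (Seq c1 c2 # K, s)) = (K, s'')" by (simp add: funpow_trans)
  then show "\<exists>n. (step ^^ n) (Seq c1 c2 # K, s) = (K, s'')"
    by (metis funpow_Suc_right o_apply)
qed

lemma exec_Loop_Suc:
  assumes "s r = Suc k" "exec c (s(r := k)) s'" "exec (Loop r c) s' s''"
  shows "exec (Loop r c) s s''"
  unfolding exec_def
proof
  fix K
  obtain m n where "(step ^^ m) (c # Loop r c # K, s(r := k)) = (Loop r c # K, s')"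
    "(step ^^ n) (Loop r c # K, s') = (K, s'')"
    using assms unfolding exec_def by blast
  then have "(step ^^ (n + m)) (step (Loop r c # K, s)) = (K, s'')"
    using assms(1) by (simp add: funpow_trans)
  then show "\<exists>n. (step ^^ n) (Loop r c # K, s) = (K, s'')"
    by (metis funpow_Suc_right o_apply)
qed

section \<open>Macros and the compilation of partial recursive functions\<close>

fun seqs :: "com list \<Rightarrow> com" where
  "seqs [] = Skip"
| "seqs (c # cs) = Seq c (seqs cs)"

definition clear :: "nat \<Rightarrow> com" where
  "clear r = Loop r Skip"

definition move :: "nat \<Rightarrow> nat \<Rightarrow> com" where
  "move a r = Loop a (Inc r)"

text \<open>A loop consumes its counter, so \<open>a\<close> is emptied into both \<open>k\<close>
  and \<open>r\<close> and then restored from \<open>k\<close>.\<close>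

definition copy :: "nat \<Rightarrow> nat \<Rightarrow> nat \<Rightarrow> com" where
  "copy k a r = Seq (Loop a (Seq (Inc k) (Inc r))) (move k a)"

lemma exec_clear: "exec (clear r) s (s(r := 0))"
  unfolding clear_def
proof (induction "s r" arbitrary: s)
  case 0
  then show ?case using exec_Loop_0[of s r Skip] by (metis fun_upd_triv)
next
  case (Suc k)
  then show ?case
    using exec_Loop_Suc[of s r k Skip "s(r := k)" "s(r := 0)"] exec_Skip by (metis fun_upd_same fun_upd_upd)
qed

lemma exec_move: "a \<noteq> r \<Longrightarrow> exec (move a r) s (s(a := 0, r := s r + s a))"
  unfolding move_def
proof (induction "s a" arbitrary: s)
  case 0
  then show ?case using exec_Loop_0[of s a "Inc r"] by (simp add: fun_upd_idem)
next
  case (Suc k)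
  let ?s = "s(a := k, r := Suc (s r))"
  have "exec (Loop a (Inc r)) ?s (?s(a := 0, r := ?s r + ?s a))"
    using Suc.hyps(1)[of ?s] Suc.prems by simp
  moreover have "?s(a := 0, r := ?s r + ?s a) = s(a := 0, r := s r + s a)"
    using Suc by (auto simp: Suc.hyps(2)[symmetric])
  moreover have "exec (Inc r) (s(a := k)) ?s"
    using exec_Inc[of r "s(a := k)"] Suc.prems by simp
  ultimately show ?case using exec_Loop_Suc[of s a k] Suc.hyps(2) by simp
qed

lemma exec_copy:
  assumes "a \<noteq> r" "a \<noteq> k" "r \<noteq> k" "s k = 0"
  shows "exec (copy k a r) s (s(r := s r + s a))"
proof -
  have "exec (Loop a (Seq (Inc k) (Inc r))) s (s(a := 0, r := s r + s a, k := s k + s a))" for s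
  proof (induction "s a" arbitrary: s)
    case 0
    then show ?case using exec_Loop_0[of s a] by (simp add: fun_upd_idem)
  next
    case (Suc x)
    let ?s = "s(a := x, k := Suc (s k), r := Suc (s r))"
    have "?s(a := 0, r := ?s r + ?s a, k := ?s k + ?s a) = s(a := 0, r := s r + s a, k := s k + s a)"
      using assms by (auto simp: Suc.hyps(2)[symmetric])
    then have "exec (Loop a (Seq (Inc k) (Inc r))) ?s (s(a := 0, r := s r + s a, k := s k + s a))"
      using Suc.hyps(1)[of ?s] assms by simp
    moreover have "exec (Seq (Inc k) (Inc r)) (s(a := x)) ?s"
      using exec_Seq[OF exec_Inc[of k "s(a := x)"] exec_Inc[of r]] assms by simp
    ultimately show ?case using exec_Loop_Suc[of s a x] Suc.hyps(2) by simp
  qed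
  note loop = this
  let ?s = "s(a := 0, r := s r + s a, k := s k + s a)"
  have "exec (copy k a r) s (?s(k := 0, a := ?s a + ?s k))"
    unfolding copy_def by (rule exec_Seq[OF loop exec_move]) (use assms in auto)
  moreover have "?s(k := 0, a := ?s a + ?s k) = s(r := s r + s a)"
    using assms by auto
  ultimately show ?thesis by simp
qed

text \<open>\<open>compile f as r k\<close> adds the value of \<open>f\<close> at the contents of the registers \<open>as\<close> to the
  zero register \<open>r\<close>; the registers from \<open>k\<close> on are scratch space, zero before and after.\<close>

function compile :: "recf \<Rightarrow> nat list \<Rightarrow> nat \<Rightarrow> nat \<Rightarrow> com" where
  "compile Zero as r k = Skip"
| "compile Succ as r k = Seq (copy k (hd as) r) (Inc r)"
| "compile (Proj i) as r k = copy k (as ! i) r"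
| "compile (Comp f gs) as r k =
     Seq (seqs (map (\<lambda>i. compile (gs ! i) as (k + i) (k + length gs)) [0..<length gs]))
       (Seq (compile f [k..<k + length gs] r (k + length gs)) (seqs (map clear [k..<k + length gs])))"
| "compile (PrimRec f g) as r k =
     Seq (compile f (tl as) r k) (Seq (copy (k + 1) (hd as) k)
      (Seq (Loop k (seqs [compile g ((k + 1) # r # tl as) (k + 2) (k + 3),
                          clear r, move (k + 2) r, Inc (k + 1)]))
           (clear (k + 1))))"
| "compile (Mu f) as r k =
     Seq (compile f (r # as) k (k + 1))
       (Loop k (seqs [clear k, Inc r, compile f (r # as) k (k + 1)]))"
  by pat_completeness auto
termination
  by (relation "measure (\<lambda>(f, _, _, _). size f)")
    (auto simp: less_Suc_eq_le intro!: trans_le_add1 size_list_estimation'[OF nth_mem])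

definition compiles :: "recf \<Rightarrow> bool" where
  "compiles f \<longleftrightarrow> (\<forall>as r k s y. computes f (map s as) y \<longrightarrow> set as \<subseteq> {..<k} \<longrightarrow> r < k \<longrightarrow>
     r \<notin> set as \<longrightarrow> s r = 0 \<longrightarrow> (\<forall>i\<ge>k. s i = 0) \<longrightarrow> exec (compile f as r k) s (s(r := y)))"

lemma compilesD:
  "compiles f \<Longrightarrow> computes f (map s as) y \<Longrightarrow> set as \<subseteq> {..<k} \<Longrightarrow> r < k \<Longrightarrow>
     r \<notin> set as \<Longrightarrow> s r = 0 \<Longrightarrow> (\<And>i. i \<ge> k \<Longrightarrow> s i = 0) \<Longrightarrow> exec (compile f as r k) s (s(r := y))"
  unfolding compiles_def by blast

lemma exec_clears:
  "exec (seqs (map clear rs)) s (\<lambda>i. if i \<in> set rs then 0 else s i)"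
proof (induction rs arbitrary: s)
  case (Cons r rs)
  have "(\<lambda>i. if i \<in> set rs then 0 else (s(r := 0)) i) = (\<lambda>i. if i \<in> set (r # rs) then 0 else s i)"
    by auto
  then show ?case using exec_Seq[OF exec_clear Cons.IH[of "s(r := 0)"]] by simp
qed (simp add: exec_Skip)

lemma map_fun_upd_notin: "r \<notin> set as \<Longrightarrow> map (s(r := y)) as = map s as"
  by (auto intro: map_cong)

lemma compiles_Comp:
  assumes f: "compiles f" and gs: "\<And>g. g \<in> set gs \<Longrightarrow> compiles g"
  shows "compiles (Comp f gs)"
  unfolding compiles_def
proof (intro allI impI)
  fix as :: "nat list" and r k :: nat and s :: "nat \<Rightarrow> nat" and y
  assume c: "computes (Comp f gs) (map s as) y" and as: "set as \<subseteq> {..<k}" and r: "r < k"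
    "r \<notin> set as" "s r = 0" and k: "\<forall>i\<ge>k. s i = (0 :: nat)"
  let ?n = "length gs"
  from c obtain ys where ys: "list_all2 (\<lambda>g y. computes g (map s as) y) gs ys" "computes f ys y"
    by cases auto
  have len: "length ys = ?n" using ys(1) by (simp add: list_all2_lengthD)
  \<comment> \<open>\<open>st m\<close> is the store once the first \<open>m\<close> inner functions
    have been evaluated, with their values in the registers from \<open>k\<close> on.\<close>
  define st where "st m = (\<lambda>i. if k \<le> i \<and> i < k + m then ys ! (i - k) else s i)" for m
  have "exec (seqs (map (\<lambda>i. compile (gs ! i) as (k + i) (k + ?n)) [m..<?n])) (st m) (st ?n)"
    if "m \<le> ?n" for m
    using that
  proof (induction m rule: inc_induct)
    case base
    show ?case by (simp add: exec_Skip)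
  next
    case (step m)
    have map: "map (st m) as = map s as" using as by (auto simp: st_def)
    have "exec (compile (gs ! m) as (k + m) (k + ?n)) (st m) ((st m)(k + m := ys ! m))"
      using step.hyps as k list_all2_nthD[OF ys(1), of m]
      by (intro compilesD gs, unfold map) (auto simp: st_def)
    moreover have "(st m)(k + m := ys ! m) = st (Suc m)"
      by (auto simp: st_def)
    ultimately show ?case
      using step by (simp add: upt_conv_Cons exec_Seq)
  qed
  moreover have "st 0 = s" by (auto simp: st_def)
  ultimately have 1: "exec (seqs (map (\<lambda>i. compile (gs ! i) as (k + i) (k + ?n)) [0..<?n])) s (st ?n)"
    by (metis le0)
  have "map (st ?n) [k..<k + ?n] = ys"
    using len by (auto simp: st_def intro: nth_equalityI)
  then have 2: "exec (compile f [k..<k + ?n] r (k + ?n)) (st ?n) ((st ?n)(r := y))"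
    using ys(2) r k by (intro compilesD f) (auto simp: st_def)
  have "(\<lambda>i. if i \<in> set [k..<k + ?n] then 0 else ((st ?n)(r := y)) i) = s(r := y)"
    using k r by (auto simp: st_def)
  then have 3: "exec (seqs (map clear [k..<k + ?n])) ((st ?n)(r := y)) (s(r := y))"
    using exec_clears[of "[k..<k + ?n]" "(st ?n)(r := y)"] by simp
  show "exec (compile (Comp f gs) as r k) s (s(r := y))"
    using exec_Seq[OF 1 exec_Seq[OF 2 3]] by simp
qed

lemma computes_PrimRec_Suc:
  "computes (PrimRec f g) (Suc n # xs) y \<Longrightarrow>
    \<exists>z. computes (PrimRec f g) (n # xs) z \<and> computes g (n # z # xs) y"
  by (erule computes.cases) auto

text \<open>Halting at a larger counter requires a value at each smaller one. These are the values
  that the compiled loop passes through.\<close>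

lemma computes_PrimRec_less:
  "computes (PrimRec f g) ((n + m) # xs) y \<Longrightarrow> \<exists>z. computes (PrimRec f g) (n # xs) z"
  by (induction m arbitrary: y) (auto dest: computes_PrimRec_Suc)

lemma compiles_PrimRec:
  assumes f: "compiles f" and g: "compiles g"
  shows "compiles (PrimRec f g)"
  unfolding compiles_def
proof (intro allI impI)
  fix as :: "nat list" and r k :: nat and s :: "nat \<Rightarrow> nat" and y
  assume c: "computes (PrimRec f g) (map s as) y" and as: "set as \<subseteq> {..<k}" and r: "r < k"
    "r \<notin> set as" "s r = 0" and k: "\<forall>i\<ge>k. s i = (0 :: nat)"
  obtain a as' where a: "as = a # as'" using c by (cases as) (auto elim: computes.cases)
  let ?body = "seqs [compile g ((k + 1) # r # as') (k + 2) (k + 3), clear r, move (k + 2) r, Inc (k + 1)]"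
  \<comment> \<open>Loop invariant: \<open>k\<close> counts the remaining rounds,
    \<open>k + 1\<close> holds the recursion counter \<open>j\<close>, and \<open>r\<close> holds
    the value at \<open>j\<close>.\<close>
  have loop: "exec (Loop k ?body) (s(k := m, k + 1 := j, r := z)) (s(k := 0, k + 1 := s a, r := y))"
    if "j + m = s a" "computes (PrimRec f g) (j # map s as') z" for m j z
    using that
  proof (induction m arbitrary: j z)
    case 0
    then have "y = z" using c a computes_deterministic by auto
    moreover have "j = s a" using 0 by simp
    ultimately show ?case using r by (simp only:) (rule exec_Loop_0, simp)
  next
    case (Suc m)
    have "computes (PrimRec f g) ((Suc j + m) # map s as') y" using c a Suc.prems by simp
    then obtain z' where z': "computes (PrimRec f g) (Suc j # map s as') z'"
      using computes_PrimRec_less by blast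
    then have gz: "computes g (j # z # map s as') z'"
      using computes_PrimRec_Suc Suc.prems(2) computes_deterministic by metis
    let ?s = "s(k := m, k + 1 := j, r := z)"
    have "map ?s as' = map s as'" using as r a by auto
    then have "map ?s ((k + 1) # r # as') = j # z # map s as'"
      by (simp only: list.map) (use r in simp)
    with gz have "computes g (map ?s ((k + 1) # r # as')) z'" by (simp only:)
    then have "exec (compile g ((k + 1) # r # as') (k + 2) (k + 3)) ?s (?s(k + 2 := z'))"
      by (rule compilesD[OF g]) (use r k as a in auto)
    moreover have "exec (clear r) (?s(k + 2 := z')) (?s(k + 2 := z', r := 0))"
      by (rule exec_clear)
    moreover have "exec (move (k + 2) r) (?s(k + 2 := z', r := 0)) (?s(r := z'))"
      using exec_move[of "k + 2" r "?s(k + 2 := z', r := 0)"] r k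
      by (simp add: fun_upd_twist[of r "k + 2"]) (simp add: fun_upd_idem)
    moreover have "exec (Inc (k + 1)) (?s(r := z')) (s(k := m, k + 1 := Suc j, r := z'))"
      using exec_Inc[of "k + 1" "?s(r := z')"] r by (simp add: fun_upd_twist[of r "Suc k"])
    ultimately have body: "exec ?body ?s (s(k := m, k + 1 := Suc j, r := z'))"
      by (simp only: seqs.simps) ((rule exec_Seq, assumption)+, rule exec_Skip)
    have upd: "(s(k := Suc m, k + 1 := j, r := z))(k := m) = ?s" using r by auto
    show ?case
    proof (rule exec_Loop_Suc)
      show "(s(k := Suc m, k + 1 := j, r := z)) k = Suc m" using r by simp
      show "exec ?body ((s(k := Suc m, k + 1 := j, r := z))(k := m)) (s(k := m, k + 1 := Suc j, r := z'))"
        unfolding upd by (rule body)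
      show "exec (Loop k ?body) (s(k := m, k + 1 := Suc j, r := z')) (s(k := 0, k + 1 := s a, r := y))"
        by (rule Suc.IH) (use Suc.prems(1) z' in auto)
    qed
  qed
  obtain z where z: "computes (PrimRec f g) (0 # map s as') z"
    using c a computes_PrimRec_less[of f g 0 "s a"] by auto
  then have "computes f (map s as') z" by (cases rule: computes.cases) simp_all
  then have 1: "exec (compile f as' r k) s (s(r := z))"
    using r k as a by (intro compilesD f) auto
  have 2: "exec (copy (k + 1) a k) (s(r := z)) (s(r := z, k := s a))"
    using exec_copy[of a k "k + 1" "s(r := z)"] r k as a by auto
  have "s(r := z, k := s a) = s(k := s a, k + 1 := 0, r := z)" using r k by auto
  then have 3: "exec (Loop k ?body) (s(r := z, k := s a)) (s(k := 0, k + 1 := s a, r := y))"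
    using loop[of 0 "s a" z] z by simp
  have "(s(k := 0, k + 1 := s a, r := y))(k + 1 := 0) = s(r := y)" using r k by auto
  then have 4: "exec (clear (k + 1)) (s(k := 0, k + 1 := s a, r := y)) (s(r := y))"
    using exec_clear by metis
  show "exec (compile (PrimRec f g) as r k) s (s(r := y))"
    using exec_Seq[OF 1 exec_Seq[OF 2 exec_Seq[OF 3 4]]] a by simp
qed

lemma compiles_Mu:
  assumes f: "compiles f"
  shows "compiles (Mu f)"
  unfolding compiles_def
proof (intro allI impI)
  fix as :: "nat list" and r k :: nat and s :: "nat \<Rightarrow> nat" and y
  assume c: "computes (Mu f) (map s as) y" and as: "set as \<subseteq> {..<k}" and r: "r < k"
    "r \<notin> set as" "s r = 0" and k: "\<forall>i\<ge>k. s i = (0 :: nat)"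
  from c have y: "computes f (y # map s as) 0" "\<forall>i<y. \<exists>v>0. computes f (i # map s as) v"
    by (cases, blast)+
  have f1: "exec (compile f (r # as) k (k + 1)) (s(r := j)) (s(r := j, k := v))"
    if "computes f (j # map s as) v" for j v
    using that as r k by (intro compilesD f) (auto simp: map_fun_upd_notin simp del: fun_upd_apply, auto)
  let ?body = "seqs [clear k, Inc r, compile f (r # as) k (k + 1)]"
  \<comment> \<open>Loop invariant: \<open>r\<close> holds the candidate and \<open>k\<close> the
    value of \<open>f\<close> there. The values below \<open>y\<close> are positive, so the loop
    stops exactly at \<open>y\<close>.\<close>
  have loop: "exec (Loop k ?body) (s(r := j, k := v)) (s(r := y))"
    if "j \<le> y" "computes f (j # map s as) v" for j v
    using that
  proof (induction "y - j" arbitrary: j v)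
    case 0
    then have "v = 0" using y(1) computes_deterministic by force
    then have "s(r := j, k := v) = s(r := y)"
      using 0 k r by (auto simp: fun_upd_idem)
    then show ?case using k r by (simp only:) (rule exec_Loop_0, simp)
  next
    case (Suc m)
    then have "j < y" by simp
    then have "v \<noteq> 0" using y(2) Suc.prems(2) computes_deterministic by fastforce
    then obtain v0 where v0: "v = Suc v0" by (cases v) auto
    obtain w where w: "computes f (Suc j # map s as) w"
      using y \<open>j < y\<close> by (metis Suc_leI le_neq_implies_less)
    have "exec (clear k) (s(r := j, k := v0)) (s(r := j))"
      using exec_clear[of k "s(r := j, k := v0)"] k r by (simp add: fun_upd_idem)
    moreover have "exec (Inc r) (s(r := j)) (s(r := Suc j))"
      using exec_Inc[of r "s(r := j)"] by simp
    ultimately have body: "exec ?body (s(r := j, k := v0)) (s(r := Suc j, k := w))"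
      using f1[OF w] by (simp only: seqs.simps) ((rule exec_Seq, assumption)+, rule exec_Skip)
    have upd: "(s(r := j, k := v))(k := v0) = s(r := j, k := v0)" by simp
    show ?case
    proof (rule exec_Loop_Suc)
      show "(s(r := j, k := v)) k = Suc v0" using v0 by simp
      show "exec ?body ((s(r := j, k := v))(k := v0)) (s(r := Suc j, k := w))"
        unfolding upd by (rule body)
      show "exec (Loop k ?body) (s(r := Suc j, k := w)) (s(r := y))"
        by (rule Suc.hyps(1)) (use Suc.hyps(2) \<open>j < y\<close> w in auto)
    qed
  qed
  obtain v where v: "computes f (0 # map s as) v" using y by (cases y) auto
  show "exec (compile (Mu f) as r k) s (s(r := y))"
  proof -
    have "s(r := 0) = s" using r by (simp add: fun_upd_idem)
    then show ?thesis
      using exec_Seq[OF f1[OF v] loop[OF _ v]] by simp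
  qed
qed

theorem compiles: "compiles f"
proof (induction f)
  case Zero
  show ?case
    unfolding compiles_def by (auto elim!: computes.cases simp: exec_Skip fun_upd_idem)
next
  case Succ
  show ?case unfolding compiles_def
  proof (intro allI impI)
    fix as :: "nat list" and r k :: nat and s :: "nat \<Rightarrow> nat" and y
    assume "computes Succ (map s as) y" "set as \<subseteq> {..<k}" "r < k" "r \<notin> set as" "s r = 0"
      "\<forall>i\<ge>k. s i = (0 :: nat)"
    moreover from this obtain a where "as = [a]" "y = Suc (s a)" by (auto elim!: computes.cases)
    ultimately show "exec (compile Succ as r k) s (s(r := y))"
      using exec_Seq[OF exec_copy[of a r k s] exec_Inc[of r]] by simp
  qed
next
  case (Proj i)
  show ?case unfolding compiles_def
  proof (intro allI impI)
    fix as :: "nat list" and r k :: nat and s :: "nat \<Rightarrow> nat" and y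
    assume *: "computes (Proj i) (map s as) y" "set as \<subseteq> {..<k}" "r < k" "r \<notin> set as" "s r = 0"
      "\<forall>i\<ge>k. s i = (0 :: nat)"
    then have i: "i < length as" "y = s (as ! i)" by (auto elim!: computes.cases)
    then have "as ! i \<in> set as" by simp
    then have "as ! i \<noteq> r" "as ! i < k" using * by auto
    then show "exec (compile (Proj i) as r k) s (s(r := y))"
      using exec_copy[of "as ! i" r k s] * i by simp
  qed
qed (auto intro: compiles_Comp compiles_PrimRec compiles_Mu)

section \<open>Queue simulation of register programs\<close>

definition halts :: "com \<Rightarrow> (nat \<Rightarrow> nat) \<Rightarrow> bool" where
  "halts c s \<longleftrightarrow> (\<exists>n. fst ((step ^^ n) ([c], s)) = [])"

lemma funpow_fixpoint: "f x = x \<Longrightarrow> (f ^^ n) x = x"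
  by (induction n) auto

lemma exec_imp_halts: "exec c s s' \<Longrightarrow> halts c s"
  unfolding exec_def halts_def by (metis fst_conv)

text \<open>Halted configurations are fixed by \<open>step\<close>, so a halt at time
  \<open>n\<close> would persist at time \<open>n + m\<close>, where the run is in
  \<open>I\<close>.\<close>

lemma not_halts_if_invariant:
  assumes reach: "(step ^^ m) ([c], s) \<in> I"
    and inv: "\<And>x. x \<in> I \<Longrightarrow> fst x \<noteq> [] \<and> step x \<in> I"
  shows "\<not> halts c s"
proof
  assume "halts c s"
  then obtain n s' where n: "(step ^^ n) ([c], s) = ([], s')"
    unfolding halts_def by (metis prod.collapse)
  have I: "(step ^^ k) ((step ^^ m) ([c], s)) \<in> I" for k
    by (induction k) (use reach inv in auto)
  have "(step ^^ n) ((step ^^ m) ([c], s)) = (step ^^ m) ((step ^^ n) ([c], s))"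
    by (metis add.commute comp_apply funpow_add)
  also have "\<dots> = ([], s')" by (simp add: n funpow_fixpoint)
  finally show False using I[of n] inv by fastforce
qed

text \<open>The appended loop turns an output into halting behaviour: a nonzero \<open>r\<close>
  starts an inner loop that restores \<open>r'\<close> after each decrement, forever.\<close>

lemma halts_Seq_Loop_iff:
  assumes "exec c s s'" "r \<noteq> r'" "s' r' = 0"
  shows "halts (Seq c (Loop r (Seq (Inc r') (Loop r' (Inc r'))))) s \<longleftrightarrow> s' r = 0"
proof (cases "s' r = 0")
  case True
  then show ?thesis
    using exec_imp_halts[OF exec_Seq[OF assms(1) exec_Loop_0]] by simp
next
  case False
  let ?d = "Loop r' (Inc r')"
  let ?L = "Loop r (Seq (Inc r') ?d)"
  define I :: "(com list \<times> (nat \<Rightarrow> nat)) set"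
    where "I = {x. \<exists>s. x = ([?d, ?L], s) \<and> s r' = 1 \<or> x = ([Inc r', ?d, ?L], s) \<and> s r' = 0}"
  obtain n where n: "(step ^^ n) ([c, ?L], s) = ([?L], s')"
    using assms(1) unfolding exec_def by blast
  have "(step ^^ 3) ([?L], s') \<in> I"
    using False assms(2,3) by (auto simp: numeral_3_eq_3 I_def)
  then have "(step ^^ (3 + n)) (step ([Seq c ?L], s)) \<in> I"
    using n by (simp add: funpow_add)
  then have "(step ^^ Suc (3 + n)) ([Seq c ?L], s) \<in> I"
    by (simp only: funpow_Suc_right o_apply)
  then have "\<not> halts (Seq c ?L) s"
    by (rule not_halts_if_invariant) (auto simp: I_def)
  then show ?thesis using False by simp
qed

section \<open>Passes over a queue\<close>

fun queue_state :: "('l \<Rightarrow> bool) \<Rightarrow> bool \<Rightarrow> 'l list \<Rightarrow> bool" where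
  "queue_state \<sigma> q [] = q"
| "queue_state \<sigma> q (a # u) = queue_state \<sigma> (q \<noteq> \<sigma> a) u"

text \<open>The letters are polymorphic so that a pass can be computed on symbols and carried over
  to their numbers by \<open>queue_map\<close>.\<close>

fun queue_out :: "('l \<Rightarrow> bool) \<Rightarrow> (bool \<Rightarrow> 'l \<Rightarrow> 'l list) \<Rightarrow> bool \<Rightarrow> 'l list \<Rightarrow> 'l list" where
  "queue_out \<sigma> \<pi> q [] = []"
| "queue_out \<sigma> \<pi> q (a # u) = \<pi> q a @ queue_out \<sigma> \<pi> (q \<noteq> \<sigma> a) u"

lemma queue_append:
  "queue_state \<sigma> q (u @ v) = queue_state \<sigma> (queue_state \<sigma> q u) v"
  "queue_out \<sigma> \<pi> q (u @ v) = queue_out \<sigma> \<pi> q u @ queue_out \<sigma> \<pi> (queue_state \<sigma> q u) v"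
  by (induction u arbitrary: q) auto

lemma queue_map:
  assumes "\<And>a. a \<in> set u \<Longrightarrow> \<sigma>' (f a) = \<sigma> a \<and> (\<forall>q. \<pi>' q (f a) = map f (\<pi> q a))"
  shows "queue_state \<sigma>' q (map f u) = queue_state \<sigma> q u"
    and "queue_out \<sigma>' \<pi>' q (map f u) = map f (queue_out \<sigma> \<pi> q u)"
  using assms by (induction u arbitrary: q) auto

lemma (in queue_transducer) queue_steps:
  "queue_step\<^sup>*\<^sup>* (u @ v, q) (v @ queue_out \<sigma> P q u, queue_state \<sigma> q u)"
proof (induction u arbitrary: v q)
  case (Cons a u)
  have "queue_step ((a # u) @ v, q) (u @ (v @ P q a), q \<noteq> \<sigma> a)"
    using queue_step.read[of a "u @ v" q] by simp
  then show ?case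
    using Cons.IH[of "v @ P q a" "q \<noteq> \<sigma> a"] by (simp add: converse_rtranclp_into_rtranclp)
qed simp

lemma (in queue_transducer) queue_pass:
  assumes "u \<noteq> []"
  shows "queue_step\<^sup>+\<^sup>+ (u, q) (queue_out \<sigma> P q u, queue_state \<sigma> q u)"
proof -
  obtain a v where u: "u = a # v" using assms by (cases u) auto
  have "queue_step (a # v, q) (v @ P q a, q \<noteq> \<sigma> a)" by (rule queue_step.read)
  then show ?thesis
    using queue_steps[of v "P q a" "q \<noteq> \<sigma> a"] u by (auto intro: rtranclp_into_tranclp2)
qed

text \<open>The primed symbols occur between the testing pass and the branching pass. The flag of
  \<open>Mark\<close> records that the last test failed, so that reading the mark flips the state back.\<close>

datatype symbol =
  Input nat | Mark "com list" bool | Mark' "com list" | Reg "com list" nat | Reg' "com list" nat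

instance symbol :: countable
  by countable_datatype

fun swaps :: "symbol \<Rightarrow> bool" where
  "swaps (Mark p z) \<longleftrightarrow> z"
| "swaps (Reg p j) \<longleftrightarrow> tests p j"
| "swaps a \<longleftrightarrow> False"

text \<open>\<open>Input 1\<close> to \<open>Input 4\<close> carry the four arguments,
  \<open>Input 5\<close> becomes the mark, and \<open>Input 6\<close> creates the registers from 4
  on with one letter each, that is, with value zero. Register \<open>N\<close> is the clock, which
  ticks at every nonempty control point. Alternating primed and unprimed symbols keeps each symbol
  out of its own output.\<close>

fun emit :: "nat \<Rightarrow> com list \<Rightarrow> bool \<Rightarrow> symbol \<Rightarrow> symbol list" where
  "emit N start q (Input i) =
     (if i \<in> {1..4} then [Reg start (i - 1)] else if i = 5 then [Mark start False]
      else if i = 6 then map (Reg start) [4..<Suc N] else [])"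
| "emit N start q (Mark p z) = [Mark' p]"
| "emit N start q (Mark' p) = [Mark (next_point p q) q]"
| "emit N start q (Reg p j) = (if tests p j \<and> q then [] else [Reg' p j])"
| "emit N start q (Reg' p j) =
     replicate (if incs p j \<or> j = N \<and> p \<noteq> [] then 2 else 1) (Reg (next_point p q) j)"

section \<open>Register contents as blocks of letters\<close>

definition blocks :: "(nat \<Rightarrow> 'a) \<Rightarrow> (nat \<Rightarrow> nat) \<Rightarrow> nat list \<Rightarrow> 'a list" where
  "blocks f s js = concat (map (\<lambda>j. replicate (2 ^ s j) (f j)) js)"

lemma blocks_simps [simp]:
  "blocks f s [] = []" "blocks f s (j # js) = replicate (2 ^ s j) (f j) @ blocks f s js"
  "blocks f s (js @ js') = blocks f s js @ blocks f s js'"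
  by (simp_all add: blocks_def)

lemma blocks_cong: "(\<And>j. j \<in> set js \<Longrightarrow> s j = s' j) \<Longrightarrow> blocks f s js = blocks f s' js"
  by (induction js) auto

definition config :: "nat \<Rightarrow> com list \<Rightarrow> bool \<Rightarrow> (nat \<Rightarrow> nat) \<Rightarrow> symbol list" where
  "config N p z s = Mark p z # blocks (Reg p) s [0..<Suc N]"

definition config' :: "nat \<Rightarrow> com list \<Rightarrow> (nat \<Rightarrow> nat) \<Rightarrow> symbol list" where
  "config' N p s = Mark' p # blocks (Reg' p) s [0..<Suc N]"

lemma tests_iff: "tests p j \<longleftrightarrow> (\<exists>c K. p = Loop j c # K)"
  by (induction p j rule: tests.induct) auto

lemma tests_unique: "tests p i \<Longrightarrow> tests p j \<Longrightarrow> i = j"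
  by (auto simp: tests_iff)

lemma queue_const:
  assumes "\<not> \<sigma> a"
  shows "queue_state \<sigma> q (replicate n a) = q"
    and "queue_out \<sigma> \<pi> q (replicate n a) = concat (replicate n (\<pi> q a))"
  using assms by (induction n) auto

text \<open>Of each pair of letters the first is copied and the second dropped. Only for
  \<open>k = 0\<close> is a letter left without a partner: it survives, in accordance with the
  truncated \<open>k - 1\<close>, and leaves the state flipped.\<close>

lemma queue_tested_block:
  assumes "tests p j"
  shows "queue_state swaps False (replicate (2 ^ k) (Reg p j)) \<longleftrightarrow> k = 0"
    and "queue_out swaps (emit N start) False (replicate (2 ^ k) (Reg p j)) = replicate (2 ^ (k - 1)) (Reg' p j)"
proof -
  have even: "\<not> queue_state swaps False (replicate (2 * n) (Reg p j))"
    "queue_out swaps (emit N start) False (replicate (2 * n) (Reg p j)) = replicate n (Reg' p j)" for n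
    using assms by (induction n) auto
  show "queue_state swaps False (replicate (2 ^ k) (Reg p j)) \<longleftrightarrow> k = 0"
    "queue_out swaps (emit N start) False (replicate (2 ^ k) (Reg p j)) = replicate (2 ^ (k - 1)) (Reg' p j)"
    using even[of "2 ^ (k - 1)"] assms by (cases k; simp)+
qed

text \<open>At most one register is tested, so a state flipped by a failed test meets only untested
  blocks afterwards. The second premise records this for the induction.\<close>

lemma queue_blocks:
  assumes "distinct js" "q \<Longrightarrow> \<forall>j\<in>set js. \<not> tests p j"
  shows "queue_state swaps q (blocks (Reg p) s js) \<longleftrightarrow> q \<or> (\<exists>j\<in>set js. tests p j \<and> s j = 0)"
    and "queue_out swaps (emit N start) q (blocks (Reg p) s js)
       = blocks (Reg' p) (\<lambda>j. s j - of_bool (tests p j)) js"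
  using assms
proof (induction js arbitrary: q)
  case (Cons j js)
  {
    case 1
    show ?case
    proof (cases "tests p j")
      case True
      then have "\<not> q" using 1(2) by auto
      moreover have "\<forall>i\<in>set js. \<not> tests p i"
        using 1(1) tests_unique[OF True] by (metis distinct.simps(2))
      ultimately show ?thesis using True Cons.IH(1) 1 by (auto simp: queue_append queue_tested_block)
    next
      case False
      then show ?thesis using Cons.IH(1) 1 by (auto simp: queue_append queue_const)
    qed
  next
    case 2
    show ?case
    proof (cases "tests p j")
      case True
      then have "\<not> q" using 2(2) by auto
      moreover have "\<forall>i\<in>set js. \<not> tests p i"
        using 2(1) tests_unique[OF True] by (metis distinct.simps(2))
      ultimately show ?thesis using True Cons.IH(2) 2 by (auto simp: queue_append queue_tested_block)
    next
      case False
      then have "concat (replicate n (emit N start q (Reg p j))) = replicate n (Reg' p j)" for n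
        by (induction n) auto
      then show ?thesis using False Cons.IH(2) 2 by (auto simp: queue_append queue_const)
    qed
  }
qed auto

lemma concat_replicate_replicate: "concat (replicate m (replicate n a)) = replicate (m * n) a"
  by (induction m) (auto simp: replicate_add)

text \<open>No primed register symbol swaps the state, so every block sees the same test result and
  moves to the same next control point.\<close>

lemma queue_blocks':
  "queue_state swaps q (blocks (Reg' p) s js) = q"
  "queue_out swaps (emit N start) q (blocks (Reg' p) s js)
     = blocks (Reg (next_point p q)) (\<lambda>j. s j + of_bool (incs p j \<or> j = N \<and> p \<noteq> [])) js"
proof -
  show "queue_state swaps q (blocks (Reg' p) s js) = q"
    by (induction js) (auto simp: queue_append queue_const)
  show "queue_out swaps (emit N start) q (blocks (Reg' p) s js)
     = blocks (Reg (next_point p q)) (\<lambda>j. s j + of_bool (incs p j \<or> j = N \<and> p \<noteq> [])) js"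
  proof (induction js)
    case (Cons j js)
    let ?b = "incs p j \<or> j = N \<and> p \<noteq> []"
    have "2 ^ s j * (if ?b then 2 else 1) = (2 :: nat) ^ (s j + of_bool ?b)" by simp
    then show ?case
      by (simp only: blocks_simps queue_append queue_const swaps.simps simp_thms emit.simps(5)
          concat_replicate_replicate Cons.IH)
  qed simp
qed

text \<open>The bound is strict, which reserves register \<open>N\<close> for the clock.\<close>

definition registers_below :: "nat \<Rightarrow> com list \<Rightarrow> bool" where
  "registers_below N p \<longleftrightarrow> (\<forall>j. tests p j \<or> incs p j \<longrightarrow> j < N)"

lemma queue_config:
  assumes "registers_below N p"
  shows "queue_state swaps z (config N p z s) = test_fails p s"
    and "queue_out swaps (emit N start) z (config N p z s) = config' N p (\<lambda>j. s j - of_bool (tests p j))"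
proof -
  have "(\<exists>j\<in>set [0..<Suc N]. tests p j \<and> s j = 0) \<longleftrightarrow> test_fails p s"
    using assms by (auto simp: test_fails_def registers_below_def)
  then show "queue_state swaps z (config N p z s) = test_fails p s"
    using queue_blocks(1)[of "[0..<Suc N]" False p s] by (simp add: config_def del: upt_Suc)
  show "queue_out swaps (emit N start) z (config N p z s) = config' N p (\<lambda>j. s j - of_bool (tests p j))"
    using queue_blocks(2)[of "[0..<Suc N]" False p N start s] by (simp add: config_def config'_def del: upt_Suc)
qed

lemma queue_config':
  "queue_state swaps q (config' N p s) = q"
  "queue_out swaps (emit N start) q (config' N p s)
     = config N (next_point p q) q (\<lambda>j. s j + of_bool (incs p j \<or> j = N \<and> p \<noteq> []))"
  by (simp_all add: config_def config'_def queue_blocks' del: upt_Suc)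

definition initial :: "(nat \<Rightarrow> nat) \<Rightarrow> symbol list" where
  "initial x = [Input 5] @ blocks (\<lambda>j. Input (Suc j)) x [0..<4] @ [Input 6]"

lemma queue_initial:
  assumes "4 \<le> N"
  shows "queue_state swaps False (initial x) = False"
    and "queue_out swaps (emit N start) False (initial x) = config N start False (\<lambda>j. if j < 4 then x j else 0)"
proof -
  have b: "queue_state swaps False (blocks (\<lambda>j. Input (Suc j)) x js) = False"
    "set js \<subseteq> {..<4} \<Longrightarrow> queue_out swaps (emit N start) False (blocks (\<lambda>j. Input (Suc j)) x js)
      = blocks (Reg start) x js" for js
  proof (induction js)
    case (Cons j js)
    case 1
    then show ?case using Cons by (simp add: queue_append queue_const)
  next
    case (Cons j js)
    case 2
    have "concat (replicate n (emit N start False (Input (Suc j)))) = replicate n (Reg start j)" for n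
      using 2 by (induction n) auto
    then show ?case using Cons 2 by (simp add: queue_append queue_const)
  qed simp_all
  show "queue_state swaps False (initial x) = False"
    using b(1) by (simp add: initial_def queue_append)
  have "[0..<Suc N] = [0..<4] @ [4..<Suc N]"
    using upt_add_eq_append[of 0 4 "N - 3"] assms by simp
  moreover have "blocks (Reg start) (\<lambda>j. if j < 4 then x j else 0) [4..<Suc N] = map (Reg start) [4..<Suc N]"
  proof -
    have "\<forall>j\<in>set js. 4 \<le> j \<Longrightarrow> blocks (Reg start) (\<lambda>j. if j < 4 then x j else 0) js = map (Reg start) js" for js
      by (induction js) auto
    then show ?thesis by simp
  qed
  moreover have "blocks (Reg start) (\<lambda>j. if j < 4 then x j else 0) [0..<4] = blocks (Reg start) x [0..<4]"
    by (rule blocks_cong) simp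
  ultimately show "queue_out swaps (emit N start) False (initial x) = config N start False (\<lambda>j. if j < 4 then x j else 0)"
    using b by (simp add: initial_def config_def queue_append subset_iff del: upt_Suc)
qed

text \<open>The numbers of the input symbols must not depend on the program, since the program computes
  with the code of the initial word.\<close>

fun symbol_code :: "symbol \<Rightarrow> nat" where
  "symbol_code (Input i) = i"
| "symbol_code a = 7 + to_nat a"

text \<open>From a point on a cycle of length \<open>n\<close>, everything reachable is reached in
  fewer than \<open>n\<close> steps, and determinism allows one point per number of steps. Each step
  before the cycle adds one point.\<close>

lemma finite_orbit:
  assumes det: "\<And>x y z. R x y \<Longrightarrow> R x z \<Longrightarrow> y = z"
    and "R\<^sup>*\<^sup>* x z" "R\<^sup>+\<^sup>+ z z"
  shows "finite {y. R\<^sup>*\<^sup>* x y}"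
  using assms(2)
proof (induction rule: converse_rtranclp_induct)
  case base
  obtain n where n: "0 < n" "(R ^^ n) z z" using assms(3) by (auto simp: tranclp_power)
  have unique: "(R ^^ k) u v \<Longrightarrow> (R ^^ k) u v' \<Longrightarrow> v = v'" for k u v v'
    by (induction k arbitrary: v v') (auto dest: det)
  have "\<exists>k<n. (R ^^ k) z y" if "R\<^sup>*\<^sup>* z y" for y
    using that
  proof (induction rule: rtranclp_induct)
    case base
    show ?case using n(1) by (intro exI[of _ 0]) simp
  next
    case (step y y')
    then obtain k where k: "k < n" "(R ^^ k) z y" by blast
    then have y': "(R ^^ Suc k) z y'" using step by auto
    show ?case
    proof (cases "Suc k = n")
      case True
      then have "y' = z" using y' n(2) unique by blast
      then show ?thesis using n(1) by (intro exI[of _ 0]) simp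
    next
      case False
      then show ?thesis using k(1) y' by (intro exI[of _ "Suc k"]) simp
    qed
  qed
  then have "{y. R\<^sup>*\<^sup>* z y} \<subseteq> (\<Union>k<n. {y. (R ^^ k) z y})" by blast
  moreover have "finite {y. (R ^^ k) z y}" for k
  proof (cases "\<exists>v. (R ^^ k) z v")
    case True
    then obtain v where "(R ^^ k) z v" by blast
    then have "{y. (R ^^ k) z y} \<subseteq> {v}" using unique by blast
    then show ?thesis by (rule finite_subset) simp
  qed simp
  ultimately show ?case by (auto intro: finite_subset)
next
  case (step u v)
  have "{y. R\<^sup>*\<^sup>* u y} \<subseteq> insert u {y. R\<^sup>*\<^sup>* v y}"
  proof (intro subsetI)
    fix y assume "y \<in> {y. R\<^sup>*\<^sup>* u y}"
    then have "R\<^sup>*\<^sup>* u y" by simp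
    then show "y \<in> insert u {y. R\<^sup>*\<^sup>* v y}"
    proof (cases rule: converse_rtranclpE)
      case (step w)
      then show ?thesis using det[OF \<open>R u v\<close>, of w] by simp
    qed simp
  qed
  then show ?case using step.IH by (rule finite_subset[OF _ finite.insertI])
qed

section \<open>The queue automaton of a program, with symbols coded as numbers\<close>

locale queue_machine =
  fixes c :: com and S :: "com list set" and N :: nat
  assumes finite_S: "finite S" and start_S: "[c] \<in> S" and nil_S: "[] \<in> S"
    and next_S: "p \<in> S \<Longrightarrow> next_point p z \<in> S"
    and N: "4 \<le> N" and below_N: "p \<in> S \<Longrightarrow> registers_below N p"
begin

definition U :: "symbol set" where
  "U = Input ` {1..6} \<union> (\<lambda>(p, z). Mark p z) ` (S \<times> UNIV) \<union> Mark' ` S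
     \<union> (\<lambda>(p, j). Reg p j) ` (S \<times> {..N}) \<union> (\<lambda>(p, j). Reg' p j) ` (S \<times> {..N})"

lemma U_simps [simp]:
  "Input i \<in> U \<longleftrightarrow> i \<in> {1..6}" "Mark p z \<in> U \<longleftrightarrow> p \<in> S" "Mark' p \<in> U \<longleftrightarrow> p \<in> S"
  "Reg p j \<in> U \<longleftrightarrow> p \<in> S \<and> j \<le> N" "Reg' p j \<in> U \<longleftrightarrow> p \<in> S \<and> j \<le> N"
  by (auto simp: U_def)

lemma finite_U: "finite U"
  using finite_S by (simp add: U_def)

lemma inj_symbol_code: "inj_on symbol_code U"
proof (rule inj_onI)
  fix a b assume "a \<in> U" "b \<in> U" "symbol_code a = symbol_code b"
  then show "a = b" by (cases a; cases b) auto
qed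

lemma symbol_code_pos: "a \<in> U \<Longrightarrow> symbol_code a \<noteq> 0"
  by (cases a) auto

lemma emit_U: "a \<in> U \<Longrightarrow> set (emit N [c] q a) \<subseteq> U"
  using start_S N by (cases a) (auto simp: next_S)

lemma emit_no_self: "a \<notin> set (emit N [c] q a)"
  by (cases a) auto

text \<open>A fresh letter above all symbol codes, to serve as the state-swapping tree edge.\<close>

definition t :: nat where
  "t = Suc (Max (symbol_code ` U))"

lemma symbol_code_less: "a \<in> U \<Longrightarrow> symbol_code a < t"
  using finite_U by (simp add: t_def less_Suc_eq_le)

definition \<sigma> :: "nat \<Rightarrow> bool" where
  "\<sigma> a \<longleftrightarrow> a = t \<or> (\<exists>b\<in>U. symbol_code b = a \<and> swaps b)"

lemma \<sigma>_symbol_code: "a \<in> U \<Longrightarrow> \<sigma> (symbol_code a) = swaps a"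
  using symbol_code_less inj_onD[OF inj_symbol_code] by (fastforce simp: \<sigma>_def)

text \<open>The data \<open>x\<close> enter only through the output of \<open>0\<close> in state
  \<open>False\<close>. The independence of all other outputs from \<open>x\<close> makes the final
  self-reference possible.\<close>

definition P :: "(nat \<Rightarrow> nat) \<Rightarrow> bool \<Rightarrow> nat \<Rightarrow> nat list" where
  "P x q a =
     (if a = 0 \<and> \<not> q then 0 # map symbol_code (initial x)
      else if a \<in> symbol_code ` U then map symbol_code (emit N [c] q (the_inv_into U symbol_code a))
      else [])"

lemma P_symbol_code: "a \<in> U \<Longrightarrow> P x q (symbol_code a) = map symbol_code (emit N [c] q a)"
  using symbol_code_pos[of a] by (simp add: P_def the_inv_into_f_f[OF inj_symbol_code] del: neq0_conv)

lemma initial_U: "set (initial x) \<subseteq> U"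
proof -
  have "set (blocks (\<lambda>j. Input (Suc j)) x js) \<subseteq> U" if "set js \<subseteq> {..<4}" for js
    using that by (induction js) auto
  moreover have "set [0..<4] \<subseteq> {..<4 :: nat}" by auto
  ultimately have "set (blocks (\<lambda>j. Input (Suc j)) x [0..<4]) \<subseteq> U" by blast
  then show ?thesis by (simp add: initial_def)
qed

sublocale queue_transducer t \<sigma> "P x" "map symbol_code (initial x)" for x
proof
  show "\<sigma> t" by (simp add: \<sigma>_def)
  have "t \<notin> symbol_code ` U" using symbol_code_less by fastforce
  moreover have "t \<noteq> 0" by (simp add: t_def)
  ultimately show "P x True t = []" by (simp add: P_def)
  show "set (P x q a) \<subseteq> {..t}" for q a
  proof (cases "a \<in> symbol_code ` U")
    case True
    then obtain b where "b \<in> U" "a = symbol_code b" by blast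
    then show ?thesis using emit_U symbol_code_less by (fastforce simp: P_symbol_code)
  next
    case False
    have "\<forall>b\<in>set (initial x). symbol_code b \<le> t"
      using initial_U[of x] symbol_code_less by (meson less_imp_le subsetD)
    then show ?thesis using False by (auto simp: P_def)
  qed
  show "P x False 0 = 0 # map symbol_code (initial x)" by (simp add: P_def)
  show "0 \<notin> set (map symbol_code (initial x))"
    using initial_U[of x] symbol_code_pos by fastforce
  show "a \<notin> set (P x q a)" if "a \<noteq> 0 \<or> q" for a q
  proof (cases "a \<in> symbol_code ` U")
    case True
    then obtain b where b: "b \<in> U" "a = symbol_code b" by blast
    then show ?thesis
      using emit_U[of b q] emit_no_self[of b q] inj_onD[OF inj_symbol_code]
      by (fastforce simp: P_symbol_code)
  qed (use that in \<open>auto simp: P_def\<close>)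
qed

section \<open>Queue runs simulate program runs\<close>

lemma symbol_pass:
  assumes "u \<noteq> []" "set u \<subseteq> U"
  shows "(queue_step x)\<^sup>+\<^sup>+ (map symbol_code u, q)
     (map symbol_code (queue_out swaps (emit N [c]) q u), queue_state swaps q u)"
proof -
  have "a \<in> set u \<Longrightarrow> \<sigma> (symbol_code a) = swaps a \<and>
      (\<forall>q. P x q (symbol_code a) = map symbol_code (emit N [c] q a))" for a
    using assms(2) by (auto simp: \<sigma>_symbol_code P_symbol_code)
  then show ?thesis
    using queue_pass[of "map symbol_code u" x q] assms(1)
      queue_map[of u \<sigma> symbol_code swaps "P x" "emit N [c]" q] by simp
qed

lemma blocks_U: "(\<And>j. j \<in> set js \<Longrightarrow> f j \<in> U) \<Longrightarrow> set (blocks f s js) \<subseteq> U"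
  by (auto simp: blocks_def)

lemma config_U: "p \<in> S \<Longrightarrow> set (config N p z s) \<subseteq> U" "p \<in> S \<Longrightarrow> set (config' N p s) \<subseteq> U"
  using blocks_U[of "[0..<Suc N]"] by (simp_all add: config_def config'_def del: upt_Suc)

text \<open>The clock value \<open>\<tau>\<close> is kept apart from the store \<open>s\<close>, so
  that the store can follow \<open>step\<close> exactly.\<close>

definition coded_config :: "com list \<Rightarrow> bool \<Rightarrow> (nat \<Rightarrow> nat) \<Rightarrow> nat \<Rightarrow> nat list \<times> bool" where
  "coded_config p z s \<tau> = (map symbol_code (config N p z (s(N := \<tau>))), z)"

text \<open>The testing pass leads to a primed configuration and the branching pass back to an
  unprimed one. The program does not touch register \<open>N\<close>, so overwriting it with the
  clock does not change the test.\<close>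

lemma queue_simulates_step:
  assumes "p \<in> S"
  shows "(queue_step x)\<^sup>+\<^sup>+ (coded_config p z s \<tau>)
     (coded_config (fst (step (p, s))) (test_fails p s) (snd (step (p, s))) (\<tau> + of_bool (p \<noteq> [])))"
proof -
  let ?s = "s(N := \<tau>)" and ?z = "test_fails p s"
  let ?s' = "\<lambda>j. ?s j - of_bool (tests p j)"
  have below: "registers_below N p" using assms by (rule below_N)
  then have N': "\<not> tests p N" "\<not> incs p N" by (auto simp: registers_below_def)
  then have tf: "test_fails p ?s = ?z" by (auto simp: test_fails_def)
  have "(queue_step x)\<^sup>+\<^sup>+ (coded_config p z s \<tau>) (map symbol_code (config' N p ?s'), ?z)"
    using symbol_pass[of "config N p z ?s" x z] config_U(1)[OF assms, of z ?s]
      queue_config(1)[OF below, of z ?s] queue_config(2)[OF below, of "[c]" z ?s] tf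
    by (simp add: coded_config_def) (simp add: config_def)
  moreover have "(\<lambda>j. ?s' j + of_bool (incs p j \<or> j = N \<and> p \<noteq> []))
      = (update p s)(N := \<tau> + of_bool (p \<noteq> []))"
    using N' by (auto simp: update_def)
  then have "queue_out swaps (emit N [c]) ?z (config' N p ?s')
      = config N (next_point p ?z) ?z ((update p s)(N := \<tau> + of_bool (p \<noteq> [])))"
    by (simp only: queue_config')
  then have "(queue_step x)\<^sup>+\<^sup>+ (map symbol_code (config' N p ?s'), ?z)
      (coded_config (next_point p ?z) ?z (update p s) (\<tau> + of_bool (p \<noteq> [])))"
    using symbol_pass[of "config' N p ?s'" x ?z] config_U(2)[OF assms, of ?s']
      queue_config'(1)[of ?z N p ?s']
    unfolding coded_config_def by (simp only:) (simp add: config'_def)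
  ultimately show ?thesis by (simp add: step_def)
qed

lemma step_S: "fst y \<in> S \<Longrightarrow> fst ((step ^^ n) y) \<in> S"
  by (induction n) (auto simp: step_def next_S)

lemma queue_reaches_initial:
  "(queue_step x)\<^sup>*\<^sup>* ([], False) (coded_config [c] False (\<lambda>j. if j < 4 then x j else 0) 0)"
proof -
  have "initial x \<noteq> []" by (simp add: initial_def)
  have "\<not> \<sigma> 0" using symbol_code_pos by (auto simp: \<sigma>_def t_def)
  then have "queue_step x ([], False) (map symbol_code (initial x), False)"
    using queue_step.start[of x] by simp
  moreover have "(\<lambda>j. if j < 4 then x j else 0)(N := 0) = (\<lambda>j. if j < 4 then x j else 0)"
    using N by auto
  ultimately show ?thesis
    using symbol_pass[OF \<open>initial x \<noteq> []\<close> initial_U, of x False] queue_initial(1)[of N x] queue_initial(2)[of N "[c]" x] N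
    by (simp add: coded_config_def tranclp_into_rtranclp converse_rtranclp_into_rtranclp)
qed

text \<open>The clock counts the steps until the program halts and stands still afterwards, hence
  the condition on \<open>\<tau>\<close>.\<close>

lemma queue_reaches:
  fixes x
  defines "y \<equiv> ([c], \<lambda>j. if j < 4 then x j else 0)"
  shows "\<exists>z \<tau>. (queue_step x)\<^sup>*\<^sup>* ([], False)
      (coded_config (fst ((step ^^ n) y)) z (snd ((step ^^ n) y)) \<tau>) \<and>
      ((\<forall>i<n. fst ((step ^^ i) y) \<noteq> []) \<longrightarrow> \<tau> = n)"
proof (induction n)
  case 0
  then show ?case using queue_reaches_initial[of x] by (auto simp: y_def)
next
  case (Suc n)
  let ?p = "fst ((step ^^ n) y)" and ?s = "snd ((step ^^ n) y)"
  obtain z \<tau> where IH: "(queue_step x)\<^sup>*\<^sup>* ([], False) (coded_config ?p z ?s \<tau>)"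
    "(\<forall>i<n. fst ((step ^^ i) y) \<noteq> []) \<longrightarrow> \<tau> = n"
    using Suc by blast
  have "?p \<in> S" using step_S start_S by (simp add: y_def)
  from queue_simulates_step[OF this, of x z ?s \<tau>] IH(1)
  have "(queue_step x)\<^sup>*\<^sup>* ([], False)
      (coded_config (fst ((step ^^ Suc n) y)) (test_fails ?p ?s) (snd ((step ^^ Suc n) y)) (\<tau> + of_bool (?p \<noteq> [])))"
    by (simp add: rtranclp_trans tranclp_into_rtranclp)
  moreover have "(\<forall>i<Suc n. fst ((step ^^ i) y) \<noteq> []) \<longrightarrow> \<tau> + of_bool (?p \<noteq> []) = Suc n"
    using IH(2) by (simp add: less_Suc_eq)
  ultimately show ?case by blast
qed

text \<open>A cycle bounds the length of all reachable queues by some \<open>b\<close>, but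
  \<open>b\<close> steps without halting produce a clock block of length \<open>2 ^ b\<close>.
  Conversely, after halting the clock is frozen and the configuration repeats.\<close>

theorem reaches_cycle_iff_halts:
  "reaches_cycle x \<longleftrightarrow> halts c (\<lambda>j. if j < 4 then x j else 0)"
proof -
  let ?y = "([c], \<lambda>j. if j < 4 then x j else 0)"
  show ?thesis
  proof
    assume "reaches_cycle x"
    then have "finite {y. (queue_step x)\<^sup>*\<^sup>* ([], False) y}"
      using finite_orbit[of "queue_step x"] queue_step_deterministic
      unfolding reaches_cycle_iff_queue by blast
    then have "finite ((length \<circ> fst) ` {y. (queue_step x)\<^sup>*\<^sup>* ([], False) y})" by simp
    then obtain b where "\<forall>n\<in>(length \<circ> fst) ` {y. (queue_step x)\<^sup>*\<^sup>* ([], False) y}. n \<le> b"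
      unfolding finite_nat_set_iff_bounded_le by blast
    then have b: "length (fst y) \<le> b" if "(queue_step x)\<^sup>*\<^sup>* ([], False) y" for y
      using that by (cases y) auto
    show "halts c (\<lambda>j. if j < 4 then x j else 0)"
    proof (rule ccontr)
      assume "\<not> halts c (\<lambda>j. if j < 4 then x j else 0)"
      then have "\<forall>i<b. fst ((step ^^ i) ?y) \<noteq> []" by (simp add: halts_def)
      with queue_reaches[of x b] obtain z where
        "(queue_step x)\<^sup>*\<^sup>* ([], False) (coded_config (fst ((step ^^ b) ?y)) z (snd ((step ^^ b) ?y)) b)"
        by blast
      then have "length (fst (coded_config (fst ((step ^^ b) ?y)) z (snd ((step ^^ b) ?y)) b)) \<le> b"
        by (rule b)
      moreover have "2 ^ b \<le> length (fst (coded_config p z s b))" for p s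
        by (simp add: coded_config_def config_def)
      ultimately have "2 ^ b \<le> b" by (rule order.trans[rotated])
      then show False using less_exp[of b] by linarith
    qed
  next
    assume "halts c (\<lambda>j. if j < 4 then x j else 0)"
    then obtain n where "fst ((step ^^ n) ?y) = []" unfolding halts_def by blast
    with queue_reaches[of x n] obtain z \<tau> s where
      "(queue_step x)\<^sup>*\<^sup>* ([], False) (coded_config [] z s \<tau>)"
      by auto
    \<comment> \<open>The flag \<open>z\<close> is arbitrary: one round at the empty control point
      resets it to \<open>False\<close>, and the next round is then a cycle.\<close>
    moreover have cyc: "(queue_step x)\<^sup>+\<^sup>+ (coded_config [] z s \<tau>) (coded_config [] False s \<tau>)" for z
      using queue_simulates_step[OF nil_S, of x z s \<tau>] by (simp add: test_fails_def)
    ultimately have "(queue_step x)\<^sup>*\<^sup>* ([], False) (coded_config [] False s \<tau>)"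
      by (meson rtranclp_trans tranclp_into_rtranclp)
    then show "reaches_cycle x" using cyc unfolding reaches_cycle_iff_queue by blast
  qed
qed

end

section \<open>Computing the input code\<close>

text \<open>The effect on codes of prepending an element under \<open>list_encode\<close>.\<close>

definition code_cons :: "nat \<Rightarrow> nat \<Rightarrow> nat" where
  "code_cons x e = Suc (prod_encode (x, e))"

definition rec_add :: recf where
  "rec_add = PrimRec (Proj 0) (Comp Succ [Proj 1])"

definition rec_triangle :: recf where
  "rec_triangle = PrimRec Zero (Comp Succ [rec_add])"

definition rec_cons :: recf where
  "rec_cons = Comp Succ [Comp rec_add [Comp rec_triangle [rec_add], Proj 0]]"

fun rec_const :: "nat \<Rightarrow> recf" where
  "rec_const 0 = Zero"
| "rec_const (Suc n) = Comp Succ [rec_const n]"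

definition rec_pow2 :: recf where
  "rec_pow2 = PrimRec (rec_const 1) (Comp rec_add [Proj 1, Proj 1])"

definition rec_repeat :: "nat \<Rightarrow> recf" where
  "rec_repeat l = PrimRec (Proj 0) (Comp rec_cons [rec_const l, Proj 1])"

lemma computes_proj: "i < length xs \<Longrightarrow> xs ! i = y \<Longrightarrow> computes (Proj i) xs y"
  using computes.proj by blast

lemma computes_comp1:
  "computes g xs u \<Longrightarrow> computes f [u] y \<Longrightarrow> computes (Comp f [g]) xs y"
  by (rule computes.comp[of _ _ "[u]"]) auto

lemma computes_comp2:
  "computes g xs u \<Longrightarrow> computes h xs v \<Longrightarrow> computes f [u, v] y \<Longrightarrow> computes (Comp f [g, h]) xs y"
  by (rule computes.comp[of _ _ "[u, v]"]) auto

text \<open>Only the first two arguments are used, so that \<open>rec_add\<close> also serves as the step of a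
  recursion.\<close>

lemma computes_add: "computes rec_add (x # y # zs) (x + y)"
proof (induction x)
  case 0
  show ?case unfolding rec_add_def by (rule computes.primrec_0) (simp add: computes_proj)
next
  case (Suc x)
  have "computes (Proj 1) (x # (x + y) # y # zs) (x + y)" by (rule computes_proj) simp_all
  then have "computes (Comp Succ [Proj 1]) (x # (x + y) # y # zs) (Suc x + y)"
    by (rule computes_comp1) (simp add: computes.succ)
  then show ?case
    unfolding rec_add_def by (rule computes.primrec_Suc[OF Suc[unfolded rec_add_def]])
qed

lemma computes_triangle: "computes rec_triangle (n # zs) (triangle n)"
proof (induction n)
  case 0
  show ?case unfolding rec_triangle_def by (rule computes.primrec_0) (simp add: computes.zero)
next
  case (Suc n)
  have "computes (Comp Succ [rec_add]) (n # triangle n # zs) (triangle (Suc n))"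
    by (rule computes_comp1[OF computes_add]) (simp add: computes.succ add.commute)
  then show ?case
    unfolding rec_triangle_def
    by (rule computes.primrec_Suc[OF Suc[unfolded rec_triangle_def]])
qed

lemma computes_cons: "computes rec_cons [x, e] (code_cons x e)"
  unfolding rec_cons_def code_cons_def prod_encode_def
  by (rule computes_comp1[OF computes_comp2[OF computes_comp1[OF computes_add computes_triangle]
          computes_proj computes_add]]) (auto simp: computes.succ)

lemma computes_const: "computes (rec_const n) xs n"
  by (induction n) (auto intro: computes.zero computes_comp1 computes.succ)

lemma computes_pow2: "computes rec_pow2 [n] (2 ^ n)"
proof (induction n)
  case 0
  show ?case unfolding rec_pow2_def by (rule computes.primrec_0) (metis computes_const power_0)
next
  case (Suc n)
  have "computes (Comp rec_add [Proj 1, Proj 1]) [n, 2 ^ n] (2 ^ Suc n)"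
    by (rule computes_comp2[OF computes_proj[OF _ refl] computes_proj[OF _ refl]])
      (use computes_add[of "2 ^ n" "2 ^ n" "[]"] in \<open>auto simp: mult_2\<close>)
  then show ?case
    unfolding rec_pow2_def by (rule computes.primrec_Suc[OF Suc[unfolded rec_pow2_def]])
qed

lemma computes_repeat:
  "computes (rec_repeat l) [n, list_encode w] (list_encode (replicate n l @ w))"
proof (induction n)
  case 0
  show ?case unfolding rec_repeat_def by (rule computes.primrec_0) (simp add: computes_proj)
next
  case (Suc n)
  let ?e = "list_encode (replicate n l @ w)"
  have "computes (Comp rec_cons [rec_const l, Proj 1]) [n, ?e, list_encode w] (code_cons l ?e)"
    by (rule computes_comp2[OF computes_const computes_proj[OF _ refl]])
      (simp_all add: computes_cons)
  moreover have "code_cons l ?e = list_encode (replicate (Suc n) l @ w)"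
    by (simp add: code_cons_def)
  ultimately show ?case
    unfolding rec_repeat_def by (metis computes.primrec_Suc[OF Suc[unfolded rec_repeat_def]])
qed

section \<open>Computing the instance from its own description\<close>

definition start_word :: "(nat \<Rightarrow> nat) \<Rightarrow> nat word" where
  "start_word x = pos (0 # map symbol_code (initial x))"

definition rec_code :: "nat \<Rightarrow> nat" where
  "rec_code a = letter_code (a, True)"

definition rec_start_word :: recf where
  "rec_start_word =
     (let block = \<lambda>j e. Comp (rec_repeat (rec_code (Suc j))) [Comp rec_pow2 [Proj j], e];
          cons = \<lambda>a e. Comp rec_cons [rec_const (rec_code a), e]
      in cons 0 (cons 5 (block 0 (block 1 (block 2 (block 3 (cons 6 Zero)))))))"

lemma computes_start_word:
  assumes "length xs = 4"
  shows "computes rec_start_word xs (word_code (start_word (\<lambda>j. xs ! j)))"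
proof -
  have block: "computes (Comp (rec_repeat l) [Comp rec_pow2 [Proj j], e]) xs
      (list_encode (replicate (2 ^ (xs ! j)) l @ w))"
    if "computes e xs (list_encode w)" "j < 4" for l j e w
    using that assms
    by (intro computes_comp2[OF computes_comp1[OF computes_proj[OF _ refl] computes_pow2] _ computes_repeat]) auto
  have cons: "computes (Comp rec_cons [rec_const l, e]) xs (list_encode (l # w))"
    if "computes e xs (list_encode w)" for l e w
    using computes_comp2[OF computes_const that computes_cons] by (simp add: code_cons_def)
  have nil: "computes Zero xs (list_encode [])" using computes.zero by simp
  have w: "map letter_code (start_word (\<lambda>j. xs ! j))
      = rec_code 0 # rec_code 5 # replicate (2 ^ (xs ! 0)) (rec_code (Suc 0)) @
        replicate (2 ^ (xs ! 1)) (rec_code (Suc 1)) @ replicate (2 ^ (xs ! 2)) (rec_code (Suc 2)) @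
        replicate (2 ^ (xs ! 3)) (rec_code (Suc 3)) @ rec_code 6 # []"
    by (simp add: start_word_def initial_def pos_def rec_code_def upt_rec numeral_eq_Suc)
  show ?thesis
    unfolding word_code_def w rec_start_word_def Let_def
    by (intro cons block nil) simp_all
qed

text \<open>The third argument codes the images under \<open>g\<close> of all generators except the
  first. The missing image is the start word, which is computed from all four arguments and put in
  front.\<close>

definition rec_input :: recf where
  "rec_input = Comp rec_cons [Proj 0, Comp rec_cons [Proj 1,
     Comp rec_cons [Comp rec_cons [rec_start_word, Proj 2], Comp rec_cons [Proj 3, Zero]]]]"

lemma computes_input:
  assumes xs: "xs = [m, n, list_encode (map word_code us), list_encode (map word_code vs)]"
  shows "computes rec_input xs (input_code m n (start_word (\<lambda>j. xs ! j) # us) vs)"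
proof -
  have "computes rec_input xs
     (code_cons m (code_cons n (code_cons
        (code_cons (word_code (start_word (\<lambda>j. xs ! j))) (list_encode (map word_code us)))
        (code_cons (list_encode (map word_code vs)) 0))))"
    unfolding rec_input_def
    by (intro computes_comp2[OF _ _ computes_cons] computes_proj computes.zero computes_start_word)
      (simp_all add: xs)
  then show ?thesis by (simp add: input_code_def code_cons_def)
qed

section \<open>Self-reference and the contradiction\<close>

lemma bounded_registers:
  assumes "finite S"
  shows "\<exists>N\<ge>4. \<forall>p\<in>S. registers_below N p"
proof -
  have "finite {j. tests p j}" "finite {j. incs p j}" for p
    by (cases p; cases "hd p"; simp)+
  then have "finite (\<Union>p\<in>S. {j. tests p j} \<union> {j. incs p j})" using assms by blast
  then obtain b where "\<forall>j\<in>(\<Union>p\<in>S. {j. tests p j} \<union> {j. incs p j}). j \<le> b"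
    unfolding finite_nat_set_iff_bounded_le by blast
  then have "j < b + 4" if "p \<in> S" "tests p j \<or> incs p j" for p j
    using that by (intro le_imp_less_Suc[THEN less_le_trans, of _ b]) auto
  then have "registers_below (b + 4) p" if "p \<in> S" for p
    using that unfolding registers_below_def by blast
  then show ?thesis by (intro exI[of _ "b + 4"]) simp
qed

lemma ex_queue_machine: "\<exists>S N. queue_machine c S N"
proof -
  obtain S where S: "finite S" "[c] \<in> S" "\<forall>p\<in>S. \<forall>z. next_point p z \<in> insert [] S"
    using finite_points[of c "[]"] by blast
  obtain N where "4 \<le> N" "\<forall>p\<in>insert [] S. registers_below N p"
    using bounded_registers[of "insert [] S"] S(1) by auto
  then have "queue_machine c (insert [] S) N"
    using S by unfold_locales auto
  then show ?thesis by blast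
qed

theorem theoremA:
  "\<not> (\<exists>D :: recf. \<forall>m n us vs g h.
        hom_listed m n us g \<and> hom_listed m n vs h \<and>
        inj_on h (carrier (free_group {..<m})) \<and>
        finite (rcosets\<^bsub>free_group {..<n}\<^esub> (h ` carrier (free_group {..<m}))) \<longrightarrow>
        computes D [input_code m n us vs]
          (if equalizer (free_group {..<m}) g h \<noteq> {\<one>\<^bsub>free_group {..<m}\<^esub>} then 1 else 0))"
proof
  assume "\<exists>D :: recf. \<forall>m n us vs g h.
        hom_listed m n us g \<and> hom_listed m n vs h \<and>
        inj_on h (carrier (free_group {..<m})) \<and>
        finite (rcosets\<^bsub>free_group {..<n}\<^esub> (h ` carrier (free_group {..<m}))) \<longrightarrow>
        computes D [input_code m n us vs]
          (if equalizer (free_group {..<m}) g h \<noteq> {\<one>\<^bsub>free_group {..<m}\<^esub>} then 1 else 0)"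
  then obtain D :: recf where D: "\<And>m n us vs g h.
      hom_listed m n us g \<Longrightarrow> hom_listed m n vs h \<Longrightarrow>
      inj_on h (carrier (free_group {..<m})) \<Longrightarrow>
      finite (rcosets\<^bsub>free_group {..<n}\<^esub> (h ` carrier (free_group {..<m}))) \<Longrightarrow>
      computes D [input_code m n us vs]
        (if equalizer (free_group {..<m}) g h \<noteq> {\<one>\<^bsub>free_group {..<m}\<^esub>} then 1 else 0)"
    by blast
  define f where "f = Comp D [rec_input]"
  \<comment> \<open>Registers 0 to 3 hold the arguments and 4 the answer; 5 drives the endless loop.
    The program depends on \<open>D\<close> alone, so it is fixed before the alphabet and the
    instance are built from it.\<close>
  define c where "c = Seq (compile f [0, 1, 2, 3] 4 5) (Loop 4 (Seq (Inc 5) (Loop 5 (Inc 5))))"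
  obtain S N where "queue_machine c S N" using ex_queue_machine by blast
  then interpret queue_machine c S N .
  let ?m = "2 * t + 1" and ?n = "t + 1"
  \<comment> \<open>\<open>\<lambda>_. 0\<close> is a placeholder: from generator 1 on, the images
    are the same for all data.\<close>
  define us where "us = map (\<lambda>i. pos (P (\<lambda>_. 0) (odd i) (i div 2))) [1..<?m]"
  \<comment> \<open>The description omits the image of generator 0, so it can be written down before
    that image. Taking \<open>xs\<close> itself as the data of the start word closes the
    circle.\<close>
  define xs where "xs = [?m, ?n, list_encode (map word_code us), list_encode (map word_code generator_images)]"
  let ?x = "\<lambda>j. xs ! j"
  have "pos (P ?x (odd i) (i div 2)) = pos (P (\<lambda>_. 0) (odd i) (i div 2))" if "1 \<le> i" for i
  proof -
    have "odd i \<or> i div 2 \<noteq> 0" using that by (cases "i = 1") auto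
    then show ?thesis by (auto simp: P_def)
  qed
  then have us: "output_images ?x = start_word ?x # us"
    by (simp add: us_def start_word_def P_def upt_conv_Cons del: upt_Suc pos_simps)
  have g: "hom_listed ?m ?n (output_images ?x) (subst_word (\<lambda>y. output_images ?x ! y))"
    by (rule hom_listed_exists) (simp, rule output_images_words_over)
  have h: "hom_listed ?m ?n generator_images (subst_word (\<lambda>y. generator_images ! y))"
    by (rule hom_listed_exists) (simp, rule generator_images_words_over)
  let ?y = "if reaches_cycle ?x then 1 else 0"
  have "computes D [input_code ?m ?n (start_word ?x # us) generator_images] ?y"
    \<comment> \<open>\<open>D\<close> is asked about the very instance whose queue automaton runs
      \<open>c\<close> on \<open>xs\<close>.\<close>
    using D[OF g h inj_on_h[OF g h] finite_rcosets_h[OF g h]]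
    unfolding equalizer_nontrivial_iff[OF g h] unfolding us .
  then have "computes f xs ?y"
    unfolding f_def by (rule computes_comp1[OF computes_input[OF xs_def]])
  let ?s = "\<lambda>j. if j < 4 then xs ! j else 0"
  have "map ?s [0, 1, 2, 3] = xs" by (simp add: xs_def)
  then have "exec (compile f [0, 1, 2, 3] 4 5) ?s (?s(4 := ?y))"
    using \<open>computes f xs ?y\<close> by (intro compilesD compiles) auto
  \<comment> \<open>So \<open>c\<close> halts iff the answer is 0, that is, iff no cycle is reached,
    whereas \<open>reaches_cycle_iff_halts\<close> says the opposite.\<close>
  then have "halts c ?s \<longleftrightarrow> (?s(4 := ?y)) 4 = 0"
    unfolding c_def by (rule halts_Seq_Loop_iff) auto
  then show False using reaches_cycle_iff_halts[of ?x] by auto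
qed

end
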